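(* If $G$ is a finitely presented group with no weakly aperiodic subshift of finite type, and $H$ is a finitely generated group quasi isometric to $G$, then there exist finite index subgroups $G_0\subset G$ and $H_0\subset H$ such that $H_0$ is isomorphic to the quotient of $G_0$ by a finite (normal) subgroup.
   Context: For a finite set $A$ and a group $G$, $G$ acts on the right on $A^G$ (product topology, $A$ discrete) by $(\sigma\cdot h)(g)=\sigma(hg)$. A subshift is a closed $G$-invariant subset of $A^G$. A subshift of finite type is a set of the form $X=\bigcap_{g\in G}(C\cdot g)$, where $C=\{\sigma\in A^G:\sigma|_S\in L\}$ for some finite subset $S\subset G$ and some $L\subset A^S$. A nonempty subshift $X\subset A^G$ is weakly aperiodic if no point of $X$ has finite index stabilizer in $G$. "$G$ has no weakly aperiodic subshift of finite type" means that for every finite set $A$, no nonempty subshift of finite type $X\subset A^G$ is weakly aperiodic. A map $f:X\to Y$ of metric spaces is an $n$-quasi isometric embedding if $\frac{d(x_1,x_2)}{n}-n\le d(f(x_1),f(x_2))\le n\,d(x_1,x_2)+n$ for all $x_1,x_2\in X$, and $n$-quasi surjective if the $n$-neighborhood of $f(X)$ is all of $Y$; it is a quasi isometry if for some $n$ it is both. Finitely generated groups are quasi isometric if their Cayley graphs (with respect to finite generating sets, each edge having length $1$) are quasi isometric. *)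

theory Defs
  imports "HOL-Algebra.Generated_Groups" "HOL-Algebra.Group_Action" "HOL-Analysis.Analysis"
begin

section \<open>Finitely generated and finitely presented groups\<close>

definition generates :: "('a, 'm) monoid_scheme \<Rightarrow> 'a set \<Rightarrow> bool" where
  "generates G S \<longleftrightarrow> S \<subseteq> carrier G \<and> generate G S = carrier G"

definition finitely_generated :: "('a, 'm) monoid_scheme \<Rightarrow> bool" where
  "finitely_generated G \<longleftrightarrow> (\<exists>S. finite S \<and> generates G S)"

text \<open>The letter \<open>(x, True)\<close> stands for the generator \<open>x\<close> and \<open>(x, False)\<close> for its formal
  inverse. The free group on \<open>X\<close> consists of the words in these letters modulo insertion and
  deletion of adjacent mutually inverse letters.\<close>

type_synonym 'x word = "('x \<times> bool) list"

definition words :: "'x set \<Rightarrow> 'x word set" where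
  "words X = lists (X \<times> UNIV)"

inductive_set free_rel :: "'x set \<Rightarrow> ('x word \<times> 'x word) set" for X where
  cancel: "u \<in> words X \<Longrightarrow> v \<in> words X \<Longrightarrow> x \<in> X \<Longrightarrow>
    (u @ [(x, b), (x, \<not> b)] @ v, u @ v) \<in> free_rel X"
| refl: "u \<in> words X \<Longrightarrow> (u, u) \<in> free_rel X"
| sym: "(u, v) \<in> free_rel X \<Longrightarrow> (v, u) \<in> free_rel X"
| trans: "(u, v) \<in> free_rel X \<Longrightarrow> (v, w) \<in> free_rel X \<Longrightarrow> (u, w) \<in> free_rel X"

definition free_group :: "'x set \<Rightarrow> 'x word set monoid" where
  "free_group X =
    \<lparr>carrier = words X // free_rel X,
     monoid.mult = (\<lambda>A B. \<Union>u\<in>A. \<Union>v\<in>B. free_rel X `` {u @ v}),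
     monoid.one = free_rel X `` {[]}\<rparr>"

definition normal_closure :: "('a, 'm) monoid_scheme \<Rightarrow> 'a set \<Rightarrow> 'a set" where
  "normal_closure G R = generate G {g \<otimes>\<^bsub>G\<^esub> r \<otimes>\<^bsub>G\<^esub> inv\<^bsub>G\<^esub> g | g r. g \<in> carrier G \<and> r \<in> R}"

text \<open>Generators are taken from \<^typ>\<open>nat\<close>; up to renaming this covers every finite set.\<close>

definition finitely_presented :: "('a, 'm) monoid_scheme \<Rightarrow> bool" where
  "finitely_presented G \<longleftrightarrow>
    (\<exists>(X :: nat set) R. finite X \<and> finite R \<and> R \<subseteq> carrier (free_group X) \<and>
       G \<cong> free_group X Mod normal_closure (free_group X) R)"

definition finite_index :: "('a, 'm) monoid_scheme \<Rightarrow> 'a set \<Rightarrow> bool" where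
  "finite_index G K \<longleftrightarrow> subgroup K G \<and> finite (rcosets\<^bsub>G\<^esub> K)"

section \<open>Subshifts of finite type\<close>

text \<open>The configuration space \<open>A\<^sup>G\<close> is \<open>carrier G \<rightarrow>\<^sub>E A\<close> with the product of
  discrete topologies; \<open>shift G h \<sigma>\<close> is \<open>\<sigma> \<cdot> h\<close>.\<close>

definition shift :: "('g, 'm) monoid_scheme \<Rightarrow> 'g \<Rightarrow> ('g \<Rightarrow> 'c) \<Rightarrow> ('g \<Rightarrow> 'c)" where
  "shift G h \<sigma> = (\<lambda>g\<in>carrier G. \<sigma> (h \<otimes>\<^bsub>G\<^esub> g))"

definition subshift :: "('g, 'm) monoid_scheme \<Rightarrow> 'c set \<Rightarrow> ('g \<Rightarrow> 'c) set \<Rightarrow> bool" where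
  "subshift G A X \<longleftrightarrow>
    closedin (product_topology (\<lambda>_. discrete_topology A) (carrier G)) X \<and>
    (\<forall>h\<in>carrier G. shift G h ` X \<subseteq> X)"

definition subshift_of_finite_type ::
    "('g, 'm) monoid_scheme \<Rightarrow> 'c set \<Rightarrow> ('g \<Rightarrow> 'c) set \<Rightarrow> bool" where
  "subshift_of_finite_type G A X \<longleftrightarrow>
    (\<exists>S L. finite S \<and> S \<subseteq> carrier G \<and> L \<subseteq> (S \<rightarrow>\<^sub>E A) \<and>
       X = (\<Inter>g\<in>carrier G. shift G g ` {\<sigma> \<in> carrier G \<rightarrow>\<^sub>E A. restrict \<sigma> S \<in> L}))"

definition weakly_aperiodic :: "('g, 'm) monoid_scheme \<Rightarrow> 'c set \<Rightarrow> ('g \<Rightarrow> 'c) set \<Rightarrow> bool" where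
  "weakly_aperiodic G A X \<longleftrightarrow>
    subshift G A X \<and> X \<noteq> {} \<and> (\<forall>\<sigma>\<in>X. \<not> finite_index G (stabilizer G (shift G) \<sigma>))"

text \<open>Alphabets are finite subsets of \<^typ>\<open>nat\<close>; up to renaming this covers every finite set.\<close>

definition has_weakly_aperiodic_SFT :: "('g, 'm) monoid_scheme \<Rightarrow> bool" where
  "has_weakly_aperiodic_SFT G \<longleftrightarrow>
    (\<exists>(A :: nat set) X. finite A \<and> subshift_of_finite_type G A X \<and> weakly_aperiodic G A X)"

section \<open>Quasi isometries and Cayley graphs\<close>

definition quasi_isometric_embedding ::
    "nat \<Rightarrow> 'x set \<Rightarrow> ('x \<Rightarrow> 'x \<Rightarrow> real) \<Rightarrow> ('y \<Rightarrow> 'y \<Rightarrow> real) \<Rightarrow> ('x \<Rightarrow> 'y) \<Rightarrow> bool" where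
  "quasi_isometric_embedding n M d d' f \<longleftrightarrow>
    (\<forall>x\<in>M. \<forall>y\<in>M. d x y / real n - real n \<le> d' (f x) (f y) \<and>
                  d' (f x) (f y) \<le> real n * d x y + real n)"

definition quasi_surjective ::
    "nat \<Rightarrow> 'x set \<Rightarrow> 'y set \<Rightarrow> ('y \<Rightarrow> 'y \<Rightarrow> real) \<Rightarrow> ('x \<Rightarrow> 'y) \<Rightarrow> bool" where
  "quasi_surjective n M M' d' f \<longleftrightarrow> (\<forall>y\<in>M'. \<exists>x\<in>M. d' (f x) y \<le> real n)"

definition quasi_isometric_spaces ::
    "'x set \<Rightarrow> ('x \<Rightarrow> 'x \<Rightarrow> real) \<Rightarrow> 'y set \<Rightarrow> ('y \<Rightarrow> 'y \<Rightarrow> real) \<Rightarrow> bool" where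
  "quasi_isometric_spaces M d M' d' \<longleftrightarrow>
    (\<exists>f n. n > 0 \<and> f \<in> M \<rightarrow> M' \<and>
       quasi_isometric_embedding n M d d' f \<and> quasi_surjective n M M' d' f)"

text \<open>A graph is given by its set \<open>K\<close> of cells: the singletons of its vertices together with
  its edges, viewed as two-element sets of vertices. Points of its geometric realization are
  given by barycentric coordinates.\<close>

definition cell_points :: "'v set \<Rightarrow> ('v \<Rightarrow> real) set" where
  "cell_points e = {p. (\<forall>v. 0 \<le> p v) \<and> (\<forall>v. v \<notin> e \<longrightarrow> p v = 0) \<and> (\<Sum>v\<in>e. p v) = 1}"

definition graph_points :: "'v set set \<Rightarrow> ('v \<Rightarrow> real) set" where
  "graph_points K = (\<Union>e\<in>K. cell_points e)"

text \<open>On an edge \<open>{u, v}\<close> the following is \<open>\<bar>p u - q u\<bar> = \<bar>p v - q v\<bar>\<close>, so the edge has length 1.\<close>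

definition segment_length :: "'v set \<Rightarrow> ('v \<Rightarrow> real) \<Rightarrow> ('v \<Rightarrow> real) \<Rightarrow> real" where
  "segment_length e p q = (\<Sum>v\<in>e. \<bar>p v - q v\<bar>) / 2"

text \<open>The path metric: the infimum of the lengths of broken lines \<open>c 0, \<dots>, c n\<close> from \<open>p\<close> to \<open>q\<close>,
  the \<open>i\<close>-th segment of which lies in the cell \<open>e i\<close>.\<close>

definition graph_dist :: "'v set set \<Rightarrow> ('v \<Rightarrow> real) \<Rightarrow> ('v \<Rightarrow> real) \<Rightarrow> real" where
  "graph_dist K p q =
    Inf {(\<Sum>i<n. segment_length (e i) (c i) (c (Suc i))) | n c e.
           c 0 = p \<and> c n = q \<and>
           (\<forall>i<n. e i \<in> K \<and> c i \<in> cell_points (e i) \<and> c (Suc i) \<in> cell_points (e i))}"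

text \<open>For \<open>s = \<one>\<close> the set \<open>{g, g \<otimes> s}\<close> is just the vertex \<open>{g}\<close>, so no loop is added.\<close>

definition cayley_graph :: "('a, 'm) monoid_scheme \<Rightarrow> 'a set \<Rightarrow> 'a set set" where
  "cayley_graph G S =
    {{g} | g. g \<in> carrier G} \<union> {{g, g \<otimes>\<^bsub>G\<^esub> s} | g s. g \<in> carrier G \<and> s \<in> S}"

definition quasi_isometric_groups ::
    "('a, 'm) monoid_scheme \<Rightarrow> ('b, 'n) monoid_scheme \<Rightarrow> bool" where
  "quasi_isometric_groups G H \<longleftrightarrow>
    (\<exists>S T. finite S \<and> generates G S \<and> finite T \<and> generates H T \<and>
       quasi_isometric_spaces
         (graph_points (cayley_graph G S)) (graph_dist (cayley_graph G S))
         (graph_points (cayley_graph H T)) (graph_dist (cayley_graph H T)))"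

end

theory Submission
  imports Defs
begin

text \<open>Fix a coarse equivalence \<open>p : G \<rightarrow> H\<close>. The configurations on \<open>G\<close> whose patterns on a large ball all
  occur in the discrete derivative \<open>g \<mapsto> (k \<mapsto> p(g)\<inverse> p(gk))\<close> form a nonempty subshift of finite type, so
  one of them has a stabilizer \<open>G\<^sub>0\<close> of finite index. Since \<open>G\<close> is finitely presented, this configuration is
  the derivative of some \<open>f : G \<rightarrow> H\<close>. Because \<open>H\<close> is finitely presented as well (this is inherited
  through the quasi isometry), local resemblance to \<open>p\<close> forces the fibres of \<open>f\<close> to be uniformly bounded
  and its image to be coarsely dense. Invariance under \<open>G\<^sub>0\<close> means \<open>f(ag) = f(a) f(g)\<close> for \<open>a \<in> G\<^sub>0\<close>, so \<open>f\<close>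
  restricts to a homomorphism on \<open>G\<^sub>0\<close> with finite kernel and image of finite index.\<close>

section \<open>Words and bounded presentations\<close>

text \<open>A subshift of finite type controls local patterns only, so global properties of
  \<open>p\<close> may be lost in passing to \<open>f\<close>: a priori \<open>f\<close> could wrap
  \<open>G\<close> around \<open>H\<close> like a covering map. Hence two uses of bounded
  presentations: that of \<open>G\<close> makes local differences integrable, that of
  \<open>H\<close> kills the monodromy of fibres. Finite presentability enters only coarsely: words
  with equal values are linked by replacing subwords of bounded length. Unlike a set of relators,
  such a bound is carried along by a quasi isometry. Distances are replaced by left differences x^-1
  y lying in finite sets. They are unchanged by left translation, so the derivative of
  \<open>p\<close> takes finitely many values and determines a map up to left translation; this
  freedom turns periodicity under \<open>G\<^sub>0\<close> into multiplicativity. The radius of the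
  patterns has to be fixed before \<open>f\<close> exists. Therefore every bound on \<open>f\<close>
  is extracted from \<open>p\<close> and the presentations, and \<open>locally_like_geometry\<close>
  quantifies over \<open>f\<close> after its constants.\<close>

definition word_prod :: "('a, 'm) monoid_scheme \<Rightarrow> 'a list \<Rightarrow> 'a" where
  "word_prod G w = foldr (\<lambda>x y. x \<otimes>\<^bsub>G\<^esub> y) w \<one>\<^bsub>G\<^esub>"

lemma word_prod_Nil [simp]: "word_prod G [] = \<one>\<^bsub>G\<^esub>"
  and word_prod_Cons [simp]: "word_prod G (x # w) = x \<otimes>\<^bsub>G\<^esub> word_prod G w"
  by (simp_all add: word_prod_def)

lemma (in monoid) word_prod_closed: "set w \<subseteq> carrier G \<Longrightarrow> word_prod G w \<in> carrier G"
  by (induction w) auto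

lemma (in monoid) word_prod_append:
  "set u \<subseteq> carrier G \<Longrightarrow> set v \<subseteq> carrier G \<Longrightarrow> word_prod G (u @ v) = word_prod G u \<otimes> word_prod G v"
  by (induction u) (auto simp: m_assoc word_prod_closed)

inductive word_step :: "('a, 'm) monoid_scheme \<Rightarrow> 'a set \<Rightarrow> nat \<Rightarrow> 'a list \<Rightarrow> 'a list \<Rightarrow> bool"
  for G S N where
  word_stepI: "set u \<subseteq> S \<Longrightarrow> set v \<subseteq> S \<Longrightarrow> set r \<subseteq> S \<Longrightarrow> set r' \<subseteq> S \<Longrightarrow>
    length r \<le> N \<Longrightarrow> length r' \<le> N \<Longrightarrow> word_prod G r = word_prod G r' \<Longrightarrow>
    word_step G S N (u @ r @ v) (u @ r' @ v)"

definition word_eq :: "('a, 'm) monoid_scheme \<Rightarrow> 'a set \<Rightarrow> nat \<Rightarrow> 'a list \<Rightarrow> 'a list \<Rightarrow> bool" where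
  "word_eq G S N = (word_step G S N)\<^sup>*\<^sup>*"

lemma word_eq_refl [simp]: "word_eq G S N w w"
  by (simp add: word_eq_def)

lemma word_eq_trans [trans]: "word_eq G S N u v \<Longrightarrow> word_eq G S N v w \<Longrightarrow> word_eq G S N u w"
  by (simp add: word_eq_def)

lemma word_step_sym: "word_step G S N u v \<Longrightarrow> word_step G S N v u"
  by (erule word_step.cases) (auto intro: word_stepI)

lemma word_eq_sym: "word_eq G S N u v \<Longrightarrow> word_eq G S N v u"
  unfolding word_eq_def
  by (metis sympD sympI symp_rtranclp word_step_sym)

lemma word_eq_bounded:
  "set r \<subseteq> S \<Longrightarrow> set r' \<subseteq> S \<Longrightarrow> length r \<le> N \<Longrightarrow> length r' \<le> N \<Longrightarrow>
    word_prod G r = word_prod G r' \<Longrightarrow> word_eq G S N r r'"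
  using word_stepI[of "[]" S "[]" r r' N G] by (simp add: word_eq_def r_into_rtranclp)

lemma word_eq_context:
  assumes "word_eq G S N u v" "set a \<subseteq> S" "set b \<subseteq> S"
  shows "word_eq G S N (a @ u @ b) (a @ v @ b)"
  using assms(1) unfolding word_eq_def
proof (induction rule: rtranclp_induct)
  case (step y z)
  from step.hyps(2) have "word_step G S N (a @ y @ b) (a @ z @ b)"
  proof cases
    case (word_stepI u v r r')
    then show ?thesis
      using word_step.word_stepI[of "a @ u" S "v @ b" r r' N G] assms(2,3) by simp
  qed
  with step.IH show ?case by simp
qed simp

lemma word_eq_append:
  assumes "word_eq G S N u u'" "word_eq G S N v v'" "set u' \<subseteq> S" "set v \<subseteq> S"
  shows "word_eq G S N (u @ v) (u' @ v')"
  using word_eq_context[OF assms(1), of "[]" v] word_eq_context[OF assms(2), of u' "[]"] assms(3,4)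
  by (auto intro: word_eq_trans)

text \<open>The words over \<open>S\<close> with bounded relations present \<open>G\<close>; positive words suffice, as \<open>S\<close> will
  generate \<open>G\<close> as a monoid.\<close>

definition boundedly_presented :: "('a, 'm) monoid_scheme \<Rightarrow> 'a set \<Rightarrow> nat \<Rightarrow> bool" where
  "boundedly_presented G S N \<longleftrightarrow>
    (\<forall>u v. set u \<subseteq> S \<longrightarrow> set v \<subseteq> S \<longrightarrow> word_prod G u = word_prod G v \<longrightarrow> word_eq G S N u v)"

locale word_group = group G for G (structure) +
  fixes S
  assumes fin_S: "finite S"
    and S_closed: "S \<subseteq> carrier G"
    and ex_word: "x \<in> carrier G \<Longrightarrow> \<exists>w. set w \<subseteq> S \<and> word_prod G w = x"
begin

lemma word_closed: "set w \<subseteq> S \<Longrightarrow> word_prod G w \<in> carrier G"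
  using S_closed word_prod_closed by blast

lemma word_append:
  "set u \<subseteq> S \<Longrightarrow> set v \<subseteq> S \<Longrightarrow> word_prod G (u @ v) = word_prod G u \<otimes> word_prod G v"
  using S_closed by (intro word_prod_append) auto

text \<open>Balls of positive words need not be symmetric, which is why bounds for inverses are
  carried separately, as by \<open>inv_K\<^sub>0\<close> in \<open>local_lifting\<close>.\<close>

definition word_ball :: "nat \<Rightarrow> 'a set" where
  "word_ball n = {word_prod G w | w. set w \<subseteq> S \<and> length w \<le> n}"

lemma word_ball_finite: "finite (word_ball n)"
proof -
  have "word_ball n = word_prod G ` {w. set w \<subseteq> S \<and> length w \<le> n}"
    by (auto simp: word_ball_def)
  then show ?thesis using finite_lists_length_le[OF fin_S] by simp
qed

lemma word_ball_closed: "word_ball n \<subseteq> carrier G"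
  using word_closed by (auto simp: word_ball_def)

lemma word_ball_mono: "m \<le> n \<Longrightarrow> word_ball m \<subseteq> word_ball n"
  by (force simp: word_ball_def)

lemma one_word_ball: "\<one> \<in> word_ball n"
  unfolding word_ball_def by (auto intro!: exI[of _ "[]"])

lemma word_ball_mult: "x \<in> word_ball m \<Longrightarrow> y \<in> word_ball n \<Longrightarrow> x \<otimes> y \<in> word_ball (m + n)"
  unfolding word_ball_def
  apply clarify
  subgoal for u v
    using word_append[of u v] by (intro exI[of _ "u @ v"]) auto
  done

text \<open>Together with \<open>word_ball_finite\<close> this identifies bounded sets with finite
  ones, the bridge between the metric and the finite-set formulations.\<close>

lemma finite_subset_word_ball:
  assumes "finite B" "B \<subseteq> carrier G"
  obtains n where "B \<subseteq> word_ball n"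
  using assms
proof (induction B arbitrary: thesis)
  case (insert x B)
  obtain n where n: "B \<subseteq> word_ball n" using insert by auto
  obtain w where w: "set w \<subseteq> S" "word_prod G w = x" using ex_word insert by auto
  have "x \<in> word_ball (length w)" using w by (auto simp: word_ball_def)
  then have "insert x B \<subseteq> word_ball (max n (length w))"
    using n word_ball_mono[of n "max n (length w)"] word_ball_mono[of "length w" "max n (length w)"]
    by auto
  then show ?case by (rule insert.prems(1))
qed auto

lemma word_step_prod: "word_step G S N u v \<Longrightarrow> word_prod G u = word_prod G v"
  by (erule word_step.cases) (auto simp: word_append)

lemma word_eq_prod:
  assumes "word_eq G S N u v" 
  shows "word_prod G u = word_prod G v"
  using assms unfolding word_eq_def
  by (induction rule: rtranclp_induct) (auto simp: word_step_prod)

end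

lemma word_step_mono: "word_step G S N u v \<Longrightarrow> N \<le> N' \<Longrightarrow> word_step G S N' u v"
  by (erule word_step.cases) (auto intro!: word_stepI)

lemma boundedly_presented_mono:
  "boundedly_presented G S N \<Longrightarrow> N \<le> N' \<Longrightarrow> boundedly_presented G S N'"
  unfolding boundedly_presented_def word_eq_def
  by (metis mono_rtranclp word_step_mono)

lemma (in group) generates_word_group:
  assumes "finite S" "generates G S"
  shows "word_group G (S \<union> m_inv G ` S)"
proof
  show "finite (S \<union> m_inv G ` S)" using assms by simp
  show cl: "S \<union> m_inv G ` S \<subseteq> carrier G" using assms by (auto simp: generates_def)
  fix x assume "x \<in> carrier G"
  then have "x \<in> generate G S" using assms by (simp add: generates_def)
  then show "\<exists>w. set w \<subseteq> S \<union> m_inv G ` S \<and> word_prod G w = x"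
  proof induction
    case one
    show ?case by (intro exI[of _ "[]"]) simp
  next
    case (incl h)
    then show ?case using cl by (intro exI[of _ "[h]"]) auto
  next
    case (inv h)
    then show ?case using cl by (intro exI[of _ "[inv h]"]) auto
  next
    case (eng a b)
    then obtain u v where "set u \<subseteq> S \<union> m_inv G ` S" "word_prod G u = a"
      "set v \<subseteq> S \<union> m_inv G ` S" "word_prod G v = b" by blast
    then show ?case using cl word_prod_append[of u v] by (intro exI[of _ "u @ v"]) auto
  qed
qed

section \<open>Free groups\<close>

lemma words_append [simp]: "u @ v \<in> words X \<longleftrightarrow> u \<in> words X \<and> v \<in> words X"
  by (auto simp: words_def)

lemma words_Nil [simp]: "[] \<in> words X"
  by (simp add: words_def)

lemma words_Cons [simp]: "l # u \<in> words X \<longleftrightarrow> fst l \<in> X \<and> u \<in> words X"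
  by (cases l) (auto simp: words_def)

lemma free_rel_words: "(u, v) \<in> free_rel X \<Longrightarrow> u \<in> words X \<and> v \<in> words X"
  by (induction rule: free_rel.induct) auto

lemma equiv_free_rel: "equiv (words X) (free_rel X)"
proof (rule equivI)
  show "free_rel X \<subseteq> words X \<times> words X" using free_rel_words by auto
  show "refl_on (words X) (free_rel X)" by (auto simp: refl_on_def intro: free_rel.refl)
  show "sym (free_rel X)" by (auto simp: sym_def intro: free_rel.sym)
  show "trans (free_rel X)" by (auto simp: trans_def intro: free_rel.trans)
qed

lemma free_rel_context:
  assumes "(u, v) \<in> free_rel X" "a \<in> words X" "b \<in> words X"
  shows "(a @ u @ b, a @ v @ b) \<in> free_rel X"
  using assms(1)
proof (induction rule: free_rel.induct)
  case (cancel u v x c)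
  then show ?case using free_rel.cancel[of "a @ u" X "v @ b" x c] assms by simp
qed (auto intro: free_rel.intros simp: assms)

lemma free_rel_append:
  assumes "(u, u') \<in> free_rel X" "(v, v') \<in> free_rel X"
  shows "(u @ v, u' @ v') \<in> free_rel X"
  using free_rel_context[OF assms(1), of "[]" v] free_rel_context[OF assms(2), of u' "[]"]
    free_rel_words[OF assms(1)] free_rel_words[OF assms(2)]
  by (auto intro: free_rel.trans)

definition inv_word :: "'x word \<Rightarrow> 'x word" where
  "inv_word u = rev (map (\<lambda>(x, b). (x, \<not> b)) u)"

lemma inv_word_words [simp]: "inv_word u \<in> words X \<longleftrightarrow> u \<in> words X"
  by (force simp: inv_word_def words_def)

lemma inv_word_inv_word [simp]: "inv_word (inv_word u) = u"
  by (induction u) (auto simp: inv_word_def)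

lemma free_rel_right_inv: "u \<in> words X \<Longrightarrow> (u @ inv_word u, []) \<in> free_rel X"
proof (induction u)
  case (Cons l u)
  obtain x b where l: "l = (x, b)" by (cases l)
  have "([l] @ (u @ inv_word u) @ [(x, \<not> b)], [l] @ [] @ [(x, \<not> b)]) \<in> free_rel X"
    using Cons l by (intro free_rel_context) auto
  moreover have "([] @ [(x, b), (x, \<not> b)] @ [], [] @ []) \<in> free_rel X"
    using Cons l by (intro free_rel.cancel) auto
  ultimately show ?case by (auto simp: l inv_word_def intro: free_rel.trans)
qed (simp add: inv_word_def free_rel.refl)

definition free_class :: "'x set \<Rightarrow> 'x word \<Rightarrow> 'x word set" where
  "free_class X u = free_rel X `` {u}"

lemma free_class_eq_iff:
  "u \<in> words X \<Longrightarrow> v \<in> words X \<Longrightarrow> free_class X u = free_class X v \<longleftrightarrow> (u, v) \<in> free_rel X"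
  unfolding free_class_def using equiv_free_rel eq_equiv_class_iff by metis

lemma carrier_free_group: "carrier (free_group X) = free_class X ` words X"
  by (auto simp: free_group_def free_class_def quotient_def)

lemma one_free_group: "\<one>\<^bsub>free_group X\<^esub> = free_class X []"
  by (simp add: free_group_def free_class_def)

lemma mem_free_class: "v \<in> free_class X u \<longleftrightarrow> (u, v) \<in> free_rel X"
  by (simp add: free_class_def)

text \<open>Concatenation respects \<open>free_rel\<close>, so all classes in the double union
  coincide.\<close>

lemma mult_free_group:
  assumes "u \<in> words X" "v \<in> words X"
  shows "free_class X u \<otimes>\<^bsub>free_group X\<^esub> free_class X v = free_class X (u @ v)"
proof -
  have "free_class X (u' @ v') = free_class X (u @ v)"
    if "u' \<in> free_class X u" "v' \<in> free_class X v" for u' v'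
    using that free_rel_append[of u u' X v v'] free_rel_words[of _ _ X] assms
    by (subst free_class_eq_iff) (auto simp: mem_free_class intro: free_rel.sym)
  moreover have "u \<in> free_class X u" "v \<in> free_class X v"
    using assms by (auto simp: mem_free_class intro: free_rel.refl)
  ultimately have "(\<Union>u'\<in>free_class X u. \<Union>v'\<in>free_class X v. free_class X (u' @ v')) =
      free_class X (u @ v)"
    by blast
  then show ?thesis by (simp add: free_group_def free_class_def)
qed

lemma group_free_group: "group (free_group X)"
proof (rule groupI)
  fix x assume "x \<in> carrier (free_group X)"
  then obtain u where u: "u \<in> words X" "x = free_class X u" by (auto simp: carrier_free_group)
  have "(inv_word u @ u, []) \<in> free_rel X"
    using free_rel_right_inv[of "inv_word u" X] u by simp
  then show "\<exists>y\<in>carrier (free_group X). y \<otimes>\<^bsub>free_group X\<^esub> x = \<one>\<^bsub>free_group X\<^esub>"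
    using u by (intro bexI[of _ "free_class X (inv_word u)"])
      (auto simp: carrier_free_group mult_free_group one_free_group free_class_eq_iff)
qed (auto simp: carrier_free_group mult_free_group one_free_group)

lemma inv_free_group:
  assumes "u \<in> words X"
  shows "inv\<^bsub>free_group X\<^esub> free_class X u = free_class X (inv_word u)"
proof (rule group.inv_equality[OF group_free_group])
  show "free_class X (inv_word u) \<otimes>\<^bsub>free_group X\<^esub> free_class X u = \<one>\<^bsub>free_group X\<^esub>"
    using free_rel_right_inv[of "inv_word u" X] assms
    by (simp add: mult_free_group one_free_group free_class_eq_iff)
qed (use assms in \<open>auto simp: carrier_free_group\<close>)

text \<open>Conjugation carries a conjugate of \<open>r\<close> to another conjugate of
  \<open>r\<close>, so the generating set is itself invariant.\<close>

lemma (in group) normal_closure_normal: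
  assumes "R \<subseteq> carrier G"
  shows "normal_closure G R \<lhd> G"
  unfolding normal_closure_def
proof (rule normal_generateI)
  fix h g assume "h \<in> {g \<otimes> r \<otimes> inv g |g r. g \<in> carrier G \<and> r \<in> R}" and g: "g \<in> carrier G"
  then obtain k r where k: "h = k \<otimes> r \<otimes> inv k" "k \<in> carrier G" "r \<in> R" by blast
  have "r \<in> carrier G" using k assms by auto
  then have "g \<otimes> h \<otimes> inv g = (g \<otimes> k) \<otimes> r \<otimes> inv (g \<otimes> k)"
    using k g by (simp add: m_assoc inv_mult_group)
  then show "g \<otimes> h \<otimes> inv g \<in> {g \<otimes> r \<otimes> inv g |g r. g \<in> carrier G \<and> r \<in> R}"
    using k g by blast
qed (use assms in auto)

text \<open>The generators are the images of the signed letters, so positive words over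
  \<open>S\<close> are exactly the images of words of the free group. Free cancellations and
  insertions of relators are then replacements of bounded length.\<close>

lemma (in group) finitely_presented_bounded:
  assumes "finitely_presented G"
  obtains S N where "word_group G S" "boundedly_presented G S N"
proof -
  obtain X :: "nat set" and R where fX: "finite X" and fR: "finite R"
    and R: "R \<subseteq> carrier (free_group X)"
    and iso: "G \<cong> free_group X Mod normal_closure (free_group X) R"
    using assms by (auto simp: finitely_presented_def)
  define F where "F = free_group X"
  define K where "K = normal_closure F R"
  interpret F: group F unfolding F_def by (rule group_free_group)
  have normK: "K \<lhd> F" unfolding K_def using F.normal_closure_normal R F_def by blast
  then interpret K: normal K F .
  have "F Mod K \<cong> G" using iso iso_sym by (simp add: F_def K_def)
  then obtain \<psi> where \<psi>: "\<psi> \<in> iso (F Mod K) G" by (auto simp: is_iso_def)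
  define \<Phi> where "\<Phi> u = \<psi> (K #>\<^bsub>F\<^esub> free_class X u)" for u
  have clF: "free_class X u \<in> carrier F" if "u \<in> words X" for u
    using that by (simp add: F_def carrier_free_group)
  have coset_in: "K #>\<^bsub>F\<^esub> c \<in> carrier (F Mod K)" if "c \<in> carrier F" for c
    using that by (auto simp: FactGroup_def RCOSETS_def)
  have \<psi>_hom: "\<psi> (A \<otimes>\<^bsub>F Mod K\<^esub> B) = \<psi> A \<otimes> \<psi> B"
    if "A \<in> carrier (F Mod K)" "B \<in> carrier (F Mod K)" for A B
    using \<psi> that by (auto simp: iso_def hom_def)
  have \<psi>_cl: "\<psi> A \<in> carrier G" if "A \<in> carrier (F Mod K)" for A
    using \<psi> that by (auto simp: iso_def hom_def)
  have \<psi>_bij: "bij_betw \<psi> (carrier (F Mod K)) (carrier G)" using \<psi> by (simp add: iso_def)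
  have \<Phi>_cl: "\<Phi> u \<in> carrier G" if "u \<in> words X" for u
    unfolding \<Phi>_def using that by (intro \<psi>_cl coset_in clF)
  have \<Phi>_append: "\<Phi> (u @ v) = \<Phi> u \<otimes> \<Phi> v" if "u \<in> words X" "v \<in> words X" for u v
  proof -
    have "K #>\<^bsub>F\<^esub> free_class X (u @ v) = (K #>\<^bsub>F\<^esub> free_class X u) \<otimes>\<^bsub>F Mod K\<^esub> (K #>\<^bsub>F\<^esub> free_class X v)"
      using that K.rcos_sum[OF clF clF, of u v] by (simp add: FactGroup_def F_def mult_free_group)
    then show ?thesis unfolding \<Phi>_def using \<psi>_hom coset_in clF that by simp
  qed
  have \<Phi>_Nil: "\<Phi> [] = \<one>"
    using \<Phi>_append[of "[]" "[]"] \<Phi>_cl[of "[]"] by simp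
  have \<Phi>_rel: "\<Phi> u = \<Phi> v" if "(u, v) \<in> free_rel X" for u v
    unfolding \<Phi>_def using that free_rel_words[OF that] free_class_eq_iff by metis
  define \<pi> where "\<pi> l = \<Phi> [l]" for l
  define S where "S = \<pi> ` (X \<times> UNIV)"
  have word_\<Phi>: "word_prod G (map \<pi> u) = \<Phi> u" if "u \<in> words X" for u
    using that
  proof (induction u)
    case (Cons l u)
    then show ?case using \<Phi>_append[of "[l]" u] by (simp add: \<pi>_def)
  qed (simp add: \<Phi>_Nil)
  have set_map: "set (map \<pi> u) \<subseteq> S" if "u \<in> words X" for u
    using that by (force simp: S_def words_def)
  have lift: "\<exists>u \<in> words X. map \<pi> u = w" if "set w \<subseteq> S" for w
    using that
  proof (induction w)
    case (Cons s w)
    then obtain u l where "u \<in> words X" "map \<pi> u = w" "fst l \<in> X" "\<pi> l = s"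
      unfolding S_def by auto
    then show ?case by (intro bexI[of _ "l # u"]) auto
  qed (auto intro: bexI[of _ "[]"])
  have wg: "word_group G S"
  proof
    show "finite S" using fX by (simp add: S_def)
    show "S \<subseteq> carrier G" unfolding S_def \<pi>_def by (auto intro!: \<Phi>_cl)
    fix x assume "x \<in> carrier G"
    then obtain A where "A \<in> carrier (F Mod K)" "\<psi> A = x"
      using \<psi>_bij by (metis bij_betw_iff_bijections)
    then obtain u where "u \<in> words X" "\<Phi> u = x"
      by (auto simp: FactGroup_def RCOSETS_def F_def carrier_free_group \<Phi>_def)
    then show "\<exists>w. set w \<subseteq> S \<and> word_prod G w = x"
      using word_\<Phi> set_map by (intro exI[of _ "map \<pi> u"]) auto
  qed
  interpret word_group G S by (rule wg)
  have "\<exists>u \<in> words X. r = free_class X u" if "r \<in> R" for r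
    using R that by (auto simp: carrier_free_group)
  then obtain rel where rel: "rel r \<in> words X" "r = free_class X (rel r)" if "r \<in> R" for r
    by metis
  obtain N0 where N0: "length (rel r) \<le> N0" if "r \<in> R" for r
    using finite_nat_set_iff_bounded_le[of "(\<lambda>r. length (rel r)) ` R"] fR by auto
  \<comment> \<open>The 2 is the length of a cancelling pair of letters; \<open>N0\<close> bounds
    the chosen words for the relators.\<close>
  define N where "N = max 2 N0"
  let ?eq = "word_eq G S N"
  have eq_rel: "?eq (map \<pi> u) (map \<pi> v)" if "(u, v) \<in> free_rel X" for u v
    using that
  proof (induction rule: free_rel.induct)
    case (cancel u v x b)
    have "\<Phi> [(x, b), (x, \<not> b)] = \<Phi> []"
      using cancel by (intro \<Phi>_rel free_rel.cancel[of "[]" X "[]", simplified]) auto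
    then have "?eq (map \<pi> [(x, b), (x, \<not> b)]) (map \<pi> [])"
      using cancel by (intro word_eq_bounded set_map) (auto simp: word_\<Phi> N_def simp del: list.map word_prod_Cons word_prod_Nil)
    then show ?case
      using word_eq_context[of G S N "map \<pi> [(x, b), (x, \<not> b)]" "map \<pi> []" "map \<pi> u" "map \<pi> v"] cancel set_map
      by auto
  qed (auto intro: word_eq_sym word_eq_trans)
  \<comment> \<open>\<open>Q\<close> collects the classes that bounded replacements contract.
    \<open>K\<close> is generated by conjugates of relators, so \<open>K \<subseteq> Q\<close>
    follows once \<open>Q\<close> is a subgroup containing these; no product of conjugates has to be
    written out.\<close>
  define Q where "Q = {c \<in> carrier F. \<forall>u\<in>c. ?eq (map \<pi> u) []}"
  have Q_iff: "free_class X u \<in> Q \<longleftrightarrow> ?eq (map \<pi> u) []" if "u \<in> words X" for u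
  proof
    assume "free_class X u \<in> Q"
    then show "?eq (map \<pi> u) []"
      using free_rel.refl[OF that] by (auto simp: Q_def mem_free_class)
  next
    assume u: "?eq (map \<pi> u) []"
    have "?eq (map \<pi> v) []" if "(u, v) \<in> free_rel X" for v
      using eq_rel[OF free_rel.sym[OF that]] u by (rule word_eq_trans)
    then show "free_class X u \<in> Q" using clF[OF that] by (simp add: Q_def mem_free_class)
  qed
  have eq_inv: "?eq (map \<pi> (u @ inv_word u)) []" if "u \<in> words X" for u
    using eq_rel[OF free_rel_right_inv[OF that]] by simp
  have Q_sub: "subgroup Q F"
  proof (rule F.subgroupI)
    show "Q \<subseteq> carrier F" by (auto simp: Q_def)
    show "Q \<noteq> {}" using Q_iff[of "[]"] by auto
  next
    fix a assume a: "a \<in> Q"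
    then obtain u where u: "u \<in> words X" "a = free_class X u" by (auto simp: Q_def F_def carrier_free_group)
    have "?eq (map \<pi> u) []" using Q_iff u a by simp
    then have "?eq (map \<pi> u @ map \<pi> (inv_word u)) ([] @ map \<pi> (inv_word u))"
      using u set_map[of "inv_word u"] by (intro word_eq_append) auto
    then have "?eq (map \<pi> (inv_word u)) []"
      using eq_inv[OF u(1)] by (auto intro: word_eq_sym word_eq_trans)
    then show "inv\<^bsub>F\<^esub> a \<in> Q" using u Q_iff[of "inv_word u"] inv_free_group[of u X] by (simp add: F_def)
  next
    fix a b assume ab: "a \<in> Q" "b \<in> Q"
    then obtain u v where u: "u \<in> words X" "a = free_class X u" and v: "v \<in> words X" "b = free_class X v"
      by (auto simp: Q_def F_def carrier_free_group)
    have "?eq (map \<pi> u @ map \<pi> v) ([] @ [])"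
      using ab Q_iff u v set_map[of v] by (intro word_eq_append) auto
    then show "a \<otimes>\<^bsub>F\<^esub> b \<in> Q" using u v Q_iff[of "u @ v"] by (simp add: F_def mult_free_group)
  qed
  have K_Q: "K \<subseteq> Q"
    unfolding K_def normal_closure_def
  proof (rule F.generate_subgroup_incl[OF _ Q_sub], clarify)
    fix g r assume g: "g \<in> carrier F" and r: "r \<in> R"
    obtain u where u: "u \<in> words X" "g = free_class X u" using g by (auto simp: F_def carrier_free_group)
    have "r \<in> K" unfolding K_def normal_closure_def
      using r R F.one_closed by (intro generate.incl CollectI exI[of _ "\<one>\<^bsub>F\<^esub>"] exI[of _ r]) (auto simp: F_def[symmetric])
    then have "\<Phi> (rel r) = \<Phi> []"
      unfolding \<Phi>_def using rel[OF r] K.rcos_const[OF F.is_group, of r] K.rcos_const[OF F.is_group K.one_closed]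
      by (simp add: F_def one_free_group)
    then have "?eq (map \<pi> (rel r)) []"
      using rel[OF r] N0[OF r] set_map word_\<Phi> \<Phi>_Nil by (intro word_eq_bounded) (auto simp: N_def)
    then have "?eq (map \<pi> u @ map \<pi> (rel r) @ map \<pi> (inv_word u)) (map \<pi> u @ [] @ map \<pi> (inv_word u))"
      using u set_map[of u] set_map[of "inv_word u"] by (intro word_eq_context) auto
    then have "?eq (map \<pi> (u @ rel r @ inv_word u)) []"
      using eq_inv[OF u(1)] by (auto intro: word_eq_trans)
    then have "free_class X (u @ rel r @ inv_word u) \<in> Q"
      using u rel[OF r] by (subst Q_iff) auto
    moreover have "g \<otimes>\<^bsub>F\<^esub> free_class X (rel r) \<otimes>\<^bsub>F\<^esub> inv\<^bsub>F\<^esub> g = free_class X (u @ rel r @ inv_word u)"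
      using u rel(1)[OF r] by (simp add: F_def mult_free_group inv_free_group)
    ultimately show "g \<otimes>\<^bsub>F\<^esub> r \<otimes>\<^bsub>F\<^esub> inv\<^bsub>F\<^esub> g \<in> Q"
      using rel(2)[OF r] by simp
  qed
  have "boundedly_presented G S N"
    unfolding boundedly_presented_def
  proof (intro allI impI)
    fix w w' assume w: "set w \<subseteq> S" "set w' \<subseteq> S" "word_prod G w = word_prod G w'"
    obtain u v where u: "u \<in> words X" "map \<pi> u = w" and v: "v \<in> words X" "map \<pi> v = w'"
      using lift w by metis
    have "\<Phi> u = \<Phi> v" using w u v word_\<Phi> by metis
    then have "K #>\<^bsub>F\<^esub> free_class X u = K #>\<^bsub>F\<^esub> free_class X v"
      unfolding \<Phi>_def using \<psi>_bij coset_in clF u v by (metis bij_betw_imp_inj_on inj_on_def)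
    then have "free_class X u \<in> K #>\<^bsub>F\<^esub> free_class X v"
      using F.rcos_self[OF clF[OF u(1)] K.is_subgroup] by simp
    then have "free_class X u \<otimes>\<^bsub>F\<^esub> inv\<^bsub>F\<^esub> free_class X v \<in> K"
      using K.rcos_module_imp clF u v by blast
    then have "free_class X (u @ inv_word v) \<in> Q"
      using K_Q u v by (auto simp: F_def mult_free_group inv_free_group)
    \<comment> \<open>\<open>u\<close> is compared with \<open>v\<close> through u v^-1 v: the first
      two factors contract because their class lies in \<open>Q\<close>, the last two by free
      cancellation.\<close>
    then have "?eq (map \<pi> (u @ inv_word v) @ map \<pi> v) ([] @ map \<pi> v)"
      using u v set_map[of v] Q_iff[of "u @ inv_word v"] by (intro word_eq_append) auto
    moreover have "?eq (map \<pi> (u @ inv_word v @ v)) (map \<pi> (u @ []))"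
      using free_rel_append[OF free_rel.refl[OF u(1)] free_rel_right_inv[of "inv_word v"]] v u
      by (intro eq_rel) auto
    ultimately show "?eq w w'" using u v by (auto intro: word_eq_sym word_eq_trans)
  qed
  with wg that show ?thesis by blast
qed

section \<open>The path metric of a Cayley graph\<close>

text \<open>Keeping the length as a parameter allows paths to be concatenated before any infimum is
  taken.\<close>

definition broken_line :: "'v set set \<Rightarrow> ('v \<Rightarrow> real) \<Rightarrow> ('v \<Rightarrow> real) \<Rightarrow> real \<Rightarrow> bool" where
  "broken_line K p q l \<longleftrightarrow>
    (\<exists>n c e. l = (\<Sum>i<n. segment_length (e i) (c i) (c (Suc i))) \<and> c 0 = p \<and> c n = q \<and>
       (\<forall>i<n. e i \<in> K \<and> c i \<in> cell_points (e i) \<and> c (Suc i) \<in> cell_points (e i)))"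

lemma graph_dist_eq_Inf: "graph_dist K p q = Inf (Collect (broken_line K p q))"
  unfolding graph_dist_def broken_line_def by (rule arg_cong[where f = Inf]) auto

lemma segment_length_nonneg: "0 \<le> segment_length e p q"
  by (simp add: segment_length_def sum_nonneg)

lemma broken_line_nonneg: "broken_line K p q l \<Longrightarrow> 0 \<le> l"
  by (auto simp: broken_line_def intro!: sum_nonneg segment_length_nonneg)

lemma graph_dist_le: "broken_line K p q l \<Longrightarrow> graph_dist K p q \<le> l"
  unfolding graph_dist_eq_Inf
  by (rule cInf_lower) (auto intro!: bdd_belowI[of _ 0] dest: broken_line_nonneg)

lemma broken_line_cell:
  "e \<in> K \<Longrightarrow> p \<in> cell_points e \<Longrightarrow> q \<in> cell_points e \<Longrightarrow> broken_line K p q (segment_length e p q)"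
  unfolding broken_line_def
  by (intro exI[of _ 1] exI[of _ "\<lambda>i. if i = 0 then p else q"] exI[of _ "\<lambda>_. e"]) auto

lemma broken_line_trans:
  assumes "broken_line K p q l" "broken_line K q r m"
  shows "broken_line K p r (l + m)"
proof -
  obtain n c e where 1: "l = (\<Sum>i<n. segment_length (e i) (c i) (c (Suc i)))" "c 0 = p" "c n = q"
      "\<forall>i<n. e i \<in> K \<and> c i \<in> cell_points (e i) \<and> c (Suc i) \<in> cell_points (e i)"
    using assms(1) unfolding broken_line_def by blast
  obtain n' c' e' where 2: "m = (\<Sum>i<n'. segment_length (e' i) (c' i) (c' (Suc i)))" "c' 0 = q" "c' n' = r"
      "\<forall>i<n'. e' i \<in> K \<and> c' i \<in> cell_points (e' i) \<and> c' (Suc i) \<in> cell_points (e' i)"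
    using assms(2) unfolding broken_line_def by blast
  define C where "C i = (if i \<le> n then c i else c' (i - n))" for i
  define E where "E i = (if i < n then e i else e' (i - n))" for i
  have C_right: "C (n + i) = c' i" for i using 1 2 by (cases i) (auto simp: C_def)
  have E_right: "E (n + i) = e' i" for i by (simp add: E_def)
  have "(\<Sum>i<n + n'. segment_length (E i) (C i) (C (Suc i))) =
      (\<Sum>i<n. segment_length (E i) (C i) (C (Suc i))) +
      (\<Sum>i<n'. segment_length (E (n + i)) (C (n + i)) (C (Suc (n + i))))"
    by (induction n') (auto simp: algebra_simps)
  also have "(\<Sum>i<n. segment_length (E i) (C i) (C (Suc i))) = l"
    unfolding 1(1) by (rule sum.cong) (auto simp: C_def E_def)
  also have "(\<Sum>i<n'. segment_length (E (n + i)) (C (n + i)) (C (Suc (n + i)))) = m"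
    unfolding 2(1) using C_right[of "Suc _"] by (simp add: C_right E_right)
  finally have "l + m = (\<Sum>i<n + n'. segment_length (E i) (C i) (C (Suc i)))" by simp
  moreover have "E i \<in> K \<and> C i \<in> cell_points (E i) \<and> C (Suc i) \<in> cell_points (E i)"
    if "i < n + n'" for i
  proof (cases "i < n")
    case True
    then show ?thesis using 1 by (simp add: C_def E_def)
  next
    case False
    then have "i = n + (i - n)" "i - n < n'" using that by auto
    then show ?thesis using 2(4) C_right[of "i - n"] C_right[of "Suc (i - n)"] E_right[of "i - n"] by simp
  qed
  moreover have "C 0 = p" "C (n + n') = r" using 1 2 C_right[of n'] by (auto simp: C_def)
  ultimately show ?thesis unfolding broken_line_def by blast
qed

lemma segment_length_le_1:
  assumes "p \<in> cell_points e" "q \<in> cell_points e"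
  shows "segment_length e p q \<le> 1"
proof -
  have "(\<Sum>v\<in>e. \<bar>p v - q v\<bar>) \<le> (\<Sum>v\<in>e. p v + q v)"
    using assms by (intro sum_mono) (auto simp: cell_points_def abs_le_iff add_increasing add_increasing2)
  also have "\<dots> = 2" using assms by (simp add: cell_points_def sum.distrib)
  finally show ?thesis by (simp add: segment_length_def)
qed

definition vertex_point :: "'v \<Rightarrow> 'v \<Rightarrow> real" where
  "vertex_point v = (\<lambda>x. if x = v then 1 else 0)"

lemma vertex_point_cell: "finite e \<Longrightarrow> v \<in> e \<Longrightarrow> vertex_point v \<in> cell_points e"
  by (auto simp: vertex_point_def cell_points_def)

text \<open>If \<open>\<phi>\<close> is 1-Lipschitz on each edge, its affine extension bounds the path metric from below.\<close>

definition affine_ext :: "('v \<Rightarrow> real) \<Rightarrow> ('v \<Rightarrow> real) \<Rightarrow> real" where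
  "affine_ext \<phi> p = (\<Sum>v | p v \<noteq> 0. p v * \<phi> v)"

lemma affine_ext_cell:
  assumes "p \<in> cell_points e" "finite e"
  shows "affine_ext \<phi> p = (\<Sum>v\<in>e. p v * \<phi> v)"
  unfolding affine_ext_def using assms by (intro sum.mono_neutral_left) (auto simp: cell_points_def)

lemma affine_ext_vertex: "affine_ext \<phi> (vertex_point v) = \<phi> v"
  using affine_ext_cell[OF vertex_point_cell[of "{v}" v]] by (simp add: vertex_point_def)

lemma affine_ext_segment:
  assumes e: "e = {a, b}" and \<phi>: "\<bar>\<phi> a - \<phi> b\<bar> \<le> 1"
    and p: "p \<in> cell_points e" and q: "q \<in> cell_points e"
  shows "\<bar>affine_ext \<phi> p - affine_ext \<phi> q\<bar> \<le> segment_length e p q"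
proof (cases "a = b")
  case True
  then have "p a = q a" using p q e by (simp add: cell_points_def)
  then show ?thesis
    using True e affine_ext_cell[OF p, of \<phi>] affine_ext_cell[OF q, of \<phi>] segment_length_nonneg[of e p q] by simp
next
  case False
  then have pb: "p b = 1 - p a" and qb: "q b = 1 - q a" using p q e by (auto simp: cell_points_def)
  have "affine_ext \<phi> p - affine_ext \<phi> q = (p a - q a) * (\<phi> a - \<phi> b)"
    using False e affine_ext_cell[OF p, of \<phi>] affine_ext_cell[OF q, of \<phi>] pb qb
    by (simp add: algebra_simps)
  also have "\<bar>\<dots>\<bar> \<le> \<bar>p a - q a\<bar> * 1"
    unfolding abs_mult using \<phi> by (intro mult_left_mono) auto
  also have "\<dots> = segment_length e p q"
    using False e pb qb by (simp add: segment_length_def)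
  finally show ?thesis .
qed

lemma affine_ext_broken_line:
  assumes K: "\<And>e. e \<in> K \<Longrightarrow> \<exists>a b. e = {a, b} \<and> \<bar>\<phi> a - \<phi> b\<bar> \<le> 1"
    and "broken_line K p q l"
  shows "\<bar>affine_ext \<phi> p - affine_ext \<phi> q\<bar> \<le> l"
proof -
  obtain n c e where 1: "l = (\<Sum>i<n. segment_length (e i) (c i) (c (Suc i)))" "c 0 = p" "c n = q"
      "\<forall>i<n. e i \<in> K \<and> c i \<in> cell_points (e i) \<and> c (Suc i) \<in> cell_points (e i)"
    using assms(2) unfolding broken_line_def by blast
  have "\<bar>affine_ext \<phi> (c 0) - affine_ext \<phi> (c k)\<bar> \<le> (\<Sum>i<k. segment_length (e i) (c i) (c (Suc i)))"
    if "k \<le> n" for k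
    using that
  proof (induction k)
    case (Suc k)
    have "e k \<in> K" using 1(4) Suc.prems by simp
    then obtain a b where ab: "e k = {a, b}" "\<bar>\<phi> a - \<phi> b\<bar> \<le> 1" using K by blast
    have "c k \<in> cell_points (e k)" "c (Suc k) \<in> cell_points (e k)" using 1(4) Suc.prems by auto
    then have "\<bar>affine_ext \<phi> (c k) - affine_ext \<phi> (c (Suc k))\<bar> \<le> segment_length (e k) (c k) (c (Suc k))"
      by (rule affine_ext_segment[OF ab])
    with Suc show ?case by simp
  qed simp
  from this[of n] 1 show ?thesis by simp
qed

text \<open>The broken line in the hypothesis makes the set of lengths nonempty, so that its infimum
  really is a greatest lower bound.\<close>

lemma affine_ext_graph_dist:
  assumes K: "\<And>e. e \<in> K \<Longrightarrow> \<exists>a b. e = {a, b} \<and> \<bar>\<phi> a - \<phi> b\<bar> \<le> 1"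
    and "broken_line K p q l"
  shows "\<bar>affine_ext \<phi> p - affine_ext \<phi> q\<bar> \<le> graph_dist K p q"
  unfolding graph_dist_eq_Inf
  using assms by (intro cInf_greatest) (auto intro!: affine_ext_broken_line[where \<phi> = \<phi> and K = K])

text \<open>Passes from points of the realization to group elements. An interior point of an edge
  has both endpoints as candidates, so this is a relation and not a function.\<close>

definition vertex_near :: "'v set set \<Rightarrow> 'v \<Rightarrow> ('v \<Rightarrow> real) \<Rightarrow> bool" where
  "vertex_near K v x \<longleftrightarrow> (\<exists>e\<in>K. v \<in> e \<and> x \<in> cell_points e)"

lemma vertex_near_graph_points: "vertex_near K v x \<Longrightarrow> x \<in> graph_points K"
  by (auto simp: vertex_near_def graph_points_def)

section \<open>Comparison of the path metric of a Cayley graph with word balls\<close>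

context group
begin

lemma cayley_graph_cell:
  assumes "S \<subseteq> carrier G" "e \<in> cayley_graph G S"
  obtains g s where "g \<in> carrier G" "s \<in> insert \<one> S" "e = {g, g \<otimes> s}"
  using assms unfolding cayley_graph_def by force

lemma vertex_near_closed:
  assumes "S \<subseteq> carrier G" "vertex_near (cayley_graph G S) v x"
  shows "v \<in> carrier G"
proof -
  obtain e where e: "e \<in> cayley_graph G S" "v \<in> e" using assms(2) by (auto simp: vertex_near_def)
  obtain g s where "g \<in> carrier G" "s \<in> insert \<one> S" "e = {g, g \<otimes> s}"
    using cayley_graph_cell[OF assms(1) e(1)] by blast
  then show ?thesis using e assms(1) by auto
qed

lemma ex_vertex_near:
  assumes "x \<in> graph_points (cayley_graph G S)" "S \<subseteq> carrier G"
  shows "\<exists>v. vertex_near (cayley_graph G S) v x"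
proof -
  obtain e where e: "e \<in> cayley_graph G S" "x \<in> cell_points e"
    using assms(1) by (auto simp: graph_points_def)
  obtain g s where "e = {g, g \<otimes> s}" using cayley_graph_cell[OF assms(2) e(1)] by blast
  then show ?thesis using e unfolding vertex_near_def by blast
qed

lemma vertex_near_vertex_point:
  "g \<in> carrier G \<Longrightarrow> vertex_near (cayley_graph G S) g (vertex_point g)"
  unfolding vertex_near_def cayley_graph_def
  by (rule bexI[of _ "{g}"]) (auto intro: vertex_point_cell)

context
  fixes S assumes S: "finite S" "generates G S"
begin

interpretation word_group G "S \<union> m_inv G ` S"
  using generates_word_group S .

lemma broken_line_word:
  assumes "set w \<subseteq> S \<union> m_inv G ` S" "g \<in> carrier G"
  shows "\<exists>l \<le> real (length w).
    broken_line (cayley_graph G S) (vertex_point g) (vertex_point (g \<otimes> word_prod G w)) l"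
  using assms
proof (induction w arbitrary: g)
  case Nil
  have "broken_line (cayley_graph G S) (vertex_point g) (vertex_point g) (segment_length {g} (vertex_point g) (vertex_point g))"
    using Nil by (intro broken_line_cell vertex_point_cell) (auto simp: cayley_graph_def)
  moreover have "segment_length {g} (vertex_point g) (vertex_point g) = 0" by (simp add: segment_length_def)
  ultimately show ?case using Nil by auto
next
  case (Cons s w)
  have s: "s \<in> carrier G" using Cons.prems S_closed by auto
  have e: "{g, g \<otimes> s} \<in> cayley_graph G S"
  proof (cases "s \<in> S")
    \<comment> \<open>An inverse letter runs backwards through the edge with label \<open>t\<close>
      that starts at g s.\<close>
    case False
    then obtain t where "t \<in> S" "t \<in> carrier G" "s = inv t" using Cons.prems S by (auto simp: generates_def)
    then have "{g, g \<otimes> s} = {g \<otimes> s, g \<otimes> s \<otimes> t}" using Cons.prems by (auto simp: m_assoc)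
    then show ?thesis using \<open>t \<in> S\<close> s Cons.prems unfolding cayley_graph_def by blast
  qed (use Cons.prems in \<open>auto simp: cayley_graph_def\<close>)
  have "broken_line (cayley_graph G S) (vertex_point g) (vertex_point (g \<otimes> s))
      (segment_length {g, g \<otimes> s} (vertex_point g) (vertex_point (g \<otimes> s)))"
    by (intro broken_line_cell vertex_point_cell e) auto
  moreover obtain l where "l \<le> real (length w)"
    "broken_line (cayley_graph G S) (vertex_point (g \<otimes> s)) (vertex_point (g \<otimes> s \<otimes> word_prod G w)) l"
    using Cons.IH[of "g \<otimes> s"] Cons.prems s by auto
  moreover have "segment_length {g, g \<otimes> s} (vertex_point g) (vertex_point (g \<otimes> s)) \<le> 1"
    by (intro segment_length_le_1 vertex_point_cell) auto
  moreover have "g \<otimes> s \<otimes> word_prod G w = g \<otimes> word_prod G (s # w)"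
    using s Cons.prems word_closed by (simp add: m_assoc)
  ultimately show ?case
    by (intro exI[of _ "segment_length {g, g \<otimes> s} (vertex_point g) (vertex_point (g \<otimes> s)) + l"])
      (auto intro: broken_line_trans)
qed

text \<open>The 2 pays for the two end segments, from \<open>x\<close> to \<open>v\<close> and from
  \<open>w\<close> to \<open>y\<close>, each inside one cell.\<close>

lemma broken_line_near:
  assumes "vertex_near (cayley_graph G S) v x" "vertex_near (cayley_graph G S) w y"
    "inv v \<otimes> w \<in> word_ball n"
  shows "\<exists>l \<le> real n + 2. broken_line (cayley_graph G S) x y l"
proof -
  have SG: "S \<subseteq> carrier G" using S by (simp add: generates_def)
  note vc = vertex_near_closed[OF SG assms(1)] vertex_near_closed[OF SG assms(2)]
  obtain e where e: "e \<in> cayley_graph G S" "v \<in> e" "x \<in> cell_points e"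
    using assms(1) by (auto simp: vertex_near_def)
  obtain f where f: "f \<in> cayley_graph G S" "w \<in> f" "y \<in> cell_points f"
    using assms(2) by (auto simp: vertex_near_def)
  have ve: "vertex_point v \<in> cell_points e"
    using e SG by (intro vertex_point_cell) (auto elim!: cayley_graph_cell)
  have wf: "vertex_point w \<in> cell_points f"
    using f SG by (intro vertex_point_cell) (auto elim!: cayley_graph_cell)
  obtain u where u: "set u \<subseteq> S \<union> m_inv G ` S" "inv v \<otimes> w = word_prod G u" "length u \<le> n"
    using assms(3) by (auto simp: word_ball_def)
  have "v \<otimes> word_prod G u = w" using u vc by (metis inv_closed inv_solve_left m_closed)
  then obtain l where l: "l \<le> real (length u)" "broken_line (cayley_graph G S) (vertex_point v) (vertex_point w) l"
    using broken_line_word[OF u(1) vc(1)] by auto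
  have "broken_line (cayley_graph G S) x y
      (segment_length e x (vertex_point v) + (l + segment_length f (vertex_point w) y))"
    using broken_line_trans[OF broken_line_cell[OF e(1,3) ve]
        broken_line_trans[OF l(2) broken_line_cell[OF f(1) wf f(3)]]] .
  moreover have "segment_length e x (vertex_point v) + (l + segment_length f (vertex_point w) y) \<le> real n + 2"
    using segment_length_le_1[OF e(3) ve] segment_length_le_1[OF wf f(3)] l(1) u(3) by linarith
  ultimately show ?thesis by blast
qed

lemma graph_dist_near_le:
  assumes "vertex_near (cayley_graph G S) v x" "vertex_near (cayley_graph G S) w y"
    "inv v \<otimes> w \<in> word_ball n"
  shows "graph_dist (cayley_graph G S) x y \<le> real n + 2"
  using broken_line_near[OF assms] graph_dist_le by force

text \<open>The word length of v^-1 g changes by at most 1 along each edge, in both directions since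
  inverses of generators count as letters. Its affine extension therefore bounds the path metric
  from below, and passing from \<open>x\<close> and \<open>y\<close> to the vertices
  \<open>v\<close> and \<open>w\<close> costs 1 at each end.\<close>

lemma graph_dist_near_ge:
  assumes x: "vertex_near (cayley_graph G S) v x" and y: "vertex_near (cayley_graph G S) w y"
    and R: "graph_dist (cayley_graph G S) x y \<le> real R"
  shows "inv v \<otimes> w \<in> word_ball (R + 2)"
proof -
  have SG: "S \<subseteq> carrier G" using S by (simp add: generates_def)
  note v = vertex_near_closed[OF SG x] and w = vertex_near_closed[OF SG y]
  have ex_ball: "\<exists>n. g \<in> word_ball n" if "g \<in> carrier G" for g
    using finite_subset_word_ball[of "{g}"] that by auto
  define len where "len g = (LEAST n. inv v \<otimes> g \<in> word_ball n)" for g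
  have len: "inv v \<otimes> g \<in> word_ball (len g)" if "g \<in> carrier G" for g
    unfolding len_def using ex_ball[of "inv v \<otimes> g"] that v by (auto intro: LeastI)
  have len_v: "len v = 0" unfolding len_def using v one_word_ball by (auto intro: Least_eq_0)
  have len_step: "len (g \<otimes> s) \<le> len g + 1" if "g \<in> carrier G" "s \<in> S \<union> m_inv G ` S" for g s
  proof -
    have s: "s \<in> carrier G" using that S_closed by auto
    have "s \<in> word_ball 1" using that s unfolding word_ball_def
      by (intro CollectI exI[of _ "[s]"]) auto
    then have "inv v \<otimes> g \<otimes> s \<in> word_ball (len g + 1)" using len that by (intro word_ball_mult) auto
    then show ?thesis unfolding len_def using that s v by (intro Least_le) (simp add: m_assoc)
  qed
  define \<phi> where "\<phi> g = real (len g)" for g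
  have \<phi>: "\<exists>a b. e = {a, b} \<and> \<bar>\<phi> a - \<phi> b\<bar> \<le> 1" if e: "e \<in> cayley_graph G S" for e
  proof -
    obtain g s where gs: "g \<in> carrier G" "s \<in> insert \<one> S" "e = {g, g \<otimes> s}"
      using e SG by (auto elim!: cayley_graph_cell)
    have "\<bar>\<phi> g - \<phi> (g \<otimes> s)\<bar> \<le> 1"
    proof (cases "s = \<one>")
      case False
      then have s: "s \<in> S" "s \<in> carrier G" using gs SG by auto
      have "len (g \<otimes> s) \<le> len g + 1" "len (g \<otimes> s \<otimes> inv s) \<le> len (g \<otimes> s) + 1"
        using len_step[of g s] len_step[of "g \<otimes> s" "inv s"] s gs by auto
      then show ?thesis using s gs by (simp add: \<phi>_def m_assoc)
    qed (use gs in simp)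
    then show ?thesis using gs by blast
  qed
  obtain l where l: "broken_line (cayley_graph G S) x y l"
    using broken_line_near[OF x y] ex_ball[of "inv v \<otimes> w"] v w by auto
  have near: "\<bar>affine_ext \<phi> z - \<phi> u\<bar> \<le> 1" if z: "vertex_near (cayley_graph G S) u z" for u z
  proof -
    obtain e where e: "e \<in> cayley_graph G S" "u \<in> e" "z \<in> cell_points e"
      using z by (auto simp: vertex_near_def)
    obtain a b where ab: "e = {a, b}" "\<bar>\<phi> a - \<phi> b\<bar> \<le> 1" using \<phi> e by blast
    have ue: "vertex_point u \<in> cell_points e" using ab e by (intro vertex_point_cell) auto
    show ?thesis
      using affine_ext_segment[of e a b \<phi> z "vertex_point u"] ab e ue segment_length_le_1[OF e(3) ue]
      by (simp add: affine_ext_vertex)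
  qed
  have "\<bar>affine_ext \<phi> x - affine_ext \<phi> y\<bar> \<le> real R"
    using affine_ext_graph_dist[of "cayley_graph G S" \<phi> x y l, OF \<phi> l] R by linarith
  then have "\<phi> w \<le> real R + 2" using near[OF x] near[OF y] len_v by (simp add: \<phi>_def)
  then have "len w \<le> R + 2" by (simp add: \<phi>_def)
  then show ?thesis using len[OF w] word_ball_mono by blast
qed

end

end

section \<open>Coarse equivalences of groups\<close>

text \<open>Finite sets of left differences stand for bounded distances, so no generating set
  enters. The linear bounds of a quasi isometry are weakened to arbitrary control in both
  directions, which is all that the later arguments use.\<close>

definition coarse_equivalence ::
    "('a, 'm) monoid_scheme \<Rightarrow> ('b, 'n) monoid_scheme \<Rightarrow> ('a \<Rightarrow> 'b) \<Rightarrow> bool" where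
  "coarse_equivalence G H p \<longleftrightarrow> p \<in> carrier G \<rightarrow> carrier H \<and>
    (\<forall>B. finite B \<longrightarrow> (\<exists>C. finite C \<and> (\<forall>x\<in>carrier G. \<forall>y\<in>carrier G.
       inv\<^bsub>G\<^esub> x \<otimes>\<^bsub>G\<^esub> y \<in> B \<longrightarrow> inv\<^bsub>H\<^esub> p x \<otimes>\<^bsub>H\<^esub> p y \<in> C))) \<and>
    (\<forall>C. finite C \<longrightarrow> (\<exists>B. finite B \<and> (\<forall>x\<in>carrier G. \<forall>y\<in>carrier G.
       inv\<^bsub>H\<^esub> p x \<otimes>\<^bsub>H\<^esub> p y \<in> C \<longrightarrow> inv\<^bsub>G\<^esub> x \<otimes>\<^bsub>G\<^esub> y \<in> B))) \<and>
    (\<exists>D. finite D \<and> (\<forall>h\<in>carrier H. \<exists>g\<in>carrier G. inv\<^bsub>H\<^esub> h \<otimes>\<^bsub>H\<^esub> p g \<in> D))"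

lemma coarse_equivalence_closed:
  "coarse_equivalence G H p \<Longrightarrow> x \<in> carrier G \<Longrightarrow> p x \<in> carrier H"
  by (auto simp: coarse_equivalence_def)

lemma coarse_equivalence_bornologous:
  assumes "coarse_equivalence G H p" "finite B"
  obtains C where "finite C"
    "\<And>x y. x \<in> carrier G \<Longrightarrow> y \<in> carrier G \<Longrightarrow> inv\<^bsub>G\<^esub> x \<otimes>\<^bsub>G\<^esub> y \<in> B \<Longrightarrow> inv\<^bsub>H\<^esub> p x \<otimes>\<^bsub>H\<^esub> p y \<in> C"
  using assms unfolding coarse_equivalence_def by meson

lemma coarse_equivalence_proper:
  assumes "coarse_equivalence G H p" "finite C"
  obtains B where "finite B"
    "\<And>x y. x \<in> carrier G \<Longrightarrow> y \<in> carrier G \<Longrightarrow> inv\<^bsub>H\<^esub> p x \<otimes>\<^bsub>H\<^esub> p y \<in> C \<Longrightarrow> inv\<^bsub>G\<^esub> x \<otimes>\<^bsub>G\<^esub> y \<in> B"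
  using assms unfolding coarse_equivalence_def by meson

lemma coarse_equivalence_dense:
  assumes "coarse_equivalence G H p"
  obtains D where "finite D" "\<And>h. h \<in> carrier H \<Longrightarrow> \<exists>g\<in>carrier G. inv\<^bsub>H\<^esub> h \<otimes>\<^bsub>H\<^esub> p g \<in> D"
  using assms unfolding coarse_equivalence_def by meson

lemma set_multI: "a \<in> A \<Longrightarrow> b \<in> B \<Longrightarrow> a \<otimes>\<^bsub>G\<^esub> b \<in> A <#>\<^bsub>G\<^esub> B"
  by (auto simp: set_mult_def)

lemma finite_set_mult: "finite A \<Longrightarrow> finite B \<Longrightarrow> finite (A <#>\<^bsub>G\<^esub> B)"
  by (simp add: set_mult_def)

context group
begin

lemma ldiff_inv: "x \<in> carrier G \<Longrightarrow> y \<in> carrier G \<Longrightarrow> inv (inv x \<otimes> y) = inv y \<otimes> x"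
  by (simp add: inv_mult_group)

lemma ldiff_trans:
  "x \<in> carrier G \<Longrightarrow> y \<in> carrier G \<Longrightarrow> z \<in> carrier G \<Longrightarrow> (inv x \<otimes> y) \<otimes> (inv y \<otimes> z) = inv x \<otimes> z"
  by (metis inv_closed inv_solve_left m_assoc m_closed)

lemma mult_ldiff: "x \<in> carrier G \<Longrightarrow> y \<in> carrier G \<Longrightarrow> x \<otimes> (inv x \<otimes> y) = y"
  by (metis inv_closed inv_solve_left m_closed)

lemma ldiff_mult: "x \<in> carrier G \<Longrightarrow> y \<in> carrier G \<Longrightarrow> inv x \<otimes> (x \<otimes> y) = y"
  by (simp add: m_assoc[symmetric])

end

text \<open>The map between realizations is replaced by a map between vertices at bounded distance
  from it; each passage between points and vertices adds 2 to the radius.\<close>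

lemma quasi_isometric_groups_coarse_equivalence:
  fixes G :: "('a, 'm) monoid_scheme" and H :: "('b, 'n) monoid_scheme"
  assumes "group G" "group H" "quasi_isometric_groups G H"
  obtains q S T where "coarse_equivalence G H q" "word_group G S" "word_group H T"
proof -
  interpret G: group G by fact
  interpret H: group H by fact
  obtain S T where S: "finite S" "generates G S" and T: "finite T" "generates H T"
    and qi: "quasi_isometric_spaces
         (graph_points (cayley_graph G S)) (graph_dist (cayley_graph G S))
         (graph_points (cayley_graph H T)) (graph_dist (cayley_graph H T))"
    using assms(3) unfolding quasi_isometric_groups_def by blast
  let ?S = "S \<union> m_inv G ` S" and ?T = "T \<union> m_inv H ` T"
  interpret S: word_group G ?S using G.generates_word_group S .
  interpret T: word_group H ?T using H.generates_word_group T .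
  define K where "K = cayley_graph G S"
  define L where "L = cayley_graph H T"
  obtain f n where n: "n > 0" and f: "f \<in> graph_points K \<rightarrow> graph_points L"
    and emb: "quasi_isometric_embedding n (graph_points K) (graph_dist K) (graph_dist L) f"
    and surj: "quasi_surjective n (graph_points K) (graph_points L) (graph_dist L) f"
    using qi unfolding quasi_isometric_spaces_def K_def L_def by blast
  have SG: "S \<subseteq> carrier G" and TH: "T \<subseteq> carrier H" using S T by (auto simp: generates_def)
  note le_K = G.graph_dist_near_le[OF S, folded K_def] and ge_K = G.graph_dist_near_ge[OF S, folded K_def]
  note le_L = H.graph_dist_near_le[OF T, folded L_def] and ge_L = H.graph_dist_near_ge[OF T, folded L_def]
  have near_K: "vertex_near K g (vertex_point g)" if "g \<in> carrier G" for g
    unfolding K_def using G.vertex_near_vertex_point that .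
  have near_L: "vertex_near L h (vertex_point h)" if "h \<in> carrier H" for h
    unfolding L_def using H.vertex_near_vertex_point that .
  \<comment> \<open>\<open>f\<close> may send a vertex into the interior of an edge, so a nearby
    vertex has to be chosen.\<close>
  define q where "q g = (SOME h. vertex_near L h (f (vertex_point g)))" for g
  have pt: "vertex_point g \<in> graph_points K" if "g \<in> carrier G" for g
    using vertex_near_graph_points[OF near_K[OF that]] .
  have near_q: "vertex_near L (q g) (f (vertex_point g))" if "g \<in> carrier G" for g
  proof -
    have "f (vertex_point g) \<in> graph_points L" using f pt[OF that] by auto
    then show ?thesis unfolding q_def L_def using H.ex_vertex_near[OF _ TH] by (auto intro: someI_ex)
  qed
  have q_cl: "q g \<in> carrier H" if "g \<in> carrier G" for g
    using H.vertex_near_closed[OF TH] near_q[OF that] by (simp add: L_def)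
  have up: "graph_dist L (f x) (f y) \<le> real (n * m + n)"
    if "x \<in> graph_points K" "y \<in> graph_points K" "graph_dist K x y \<le> real m" for x y m
  proof -
    have "graph_dist L (f x) (f y) \<le> real n * graph_dist K x y + real n"
      using emb that unfolding quasi_isometric_embedding_def by blast
    also have "\<dots> \<le> real n * real m + real n" using that(3) by (intro add_right_mono mult_left_mono) auto
    finally show ?thesis by simp
  qed
  have down: "graph_dist K x y \<le> real (n * (m + n))"
    if "x \<in> graph_points K" "y \<in> graph_points K" "graph_dist L (f x) (f y) \<le> real m" for x y m
  proof -
    have "graph_dist K x y / real n - real n \<le> graph_dist L (f x) (f y)"
      using emb that unfolding quasi_isometric_embedding_def by blast
    then have "graph_dist K x y / real n \<le> real m + real n" using that(3) by linarith
    then show ?thesis using n by (simp add: divide_le_eq mult.commute)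
  qed
  have "coarse_equivalence G H q"
    unfolding coarse_equivalence_def
  proof (intro conjI allI impI)
    show "q \<in> carrier G \<rightarrow> carrier H" using q_cl by auto
  next
    fix B :: "'a set" assume "finite B"
    then obtain m where m: "B \<inter> carrier G \<subseteq> S.word_ball m"
      using S.finite_subset_word_ball[of "B \<inter> carrier G"] by auto
    \<comment> \<open>The inner 2 comes from \<open>le_K\<close>, the upper bound of the embedding
      turns r into n r + n, and the outer 2 comes from \<open>ge_L\<close>.\<close>
    have "inv\<^bsub>H\<^esub> q x \<otimes>\<^bsub>H\<^esub> q y \<in> T.word_ball (n * (m + 2) + n + 2)"
      if xy: "x \<in> carrier G" "y \<in> carrier G" "inv\<^bsub>G\<^esub> x \<otimes>\<^bsub>G\<^esub> y \<in> B" for x y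
    proof -
      have "inv\<^bsub>G\<^esub> x \<otimes>\<^bsub>G\<^esub> y \<in> S.word_ball m" using xy m by auto
      then have "graph_dist K (vertex_point x) (vertex_point y) \<le> real (m + 2)"
        using le_K[OF near_K near_K] xy by fastforce
      then show ?thesis
        using up[OF pt pt] xy by (intro ge_L[OF near_q near_q])
    qed
    then show "\<exists>C. finite C \<and> (\<forall>x\<in>carrier G. \<forall>y\<in>carrier G.
       inv\<^bsub>G\<^esub> x \<otimes>\<^bsub>G\<^esub> y \<in> B \<longrightarrow> inv\<^bsub>H\<^esub> q x \<otimes>\<^bsub>H\<^esub> q y \<in> C)"
      using T.word_ball_finite by blast
  next
    fix C :: "'b set" assume "finite C"
    then obtain m where m: "C \<inter> carrier H \<subseteq> T.word_ball m"
      using T.finite_subset_word_ball[of "C \<inter> carrier H"] by auto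
    \<comment> \<open>Solving the lower bound of the embedding for the source distance turns r into
      n (r + n).\<close>
    have "inv\<^bsub>G\<^esub> x \<otimes>\<^bsub>G\<^esub> y \<in> S.word_ball (n * (m + 2 + n) + 2)"
      if xy: "x \<in> carrier G" "y \<in> carrier G" "inv\<^bsub>H\<^esub> q x \<otimes>\<^bsub>H\<^esub> q y \<in> C" for x y
    proof -
      have "inv\<^bsub>H\<^esub> q x \<otimes>\<^bsub>H\<^esub> q y \<in> T.word_ball m" using xy m q_cl by auto
      then have "graph_dist L (f (vertex_point x)) (f (vertex_point y)) \<le> real (m + 2)"
        using le_L[OF near_q near_q] xy by fastforce
      then show ?thesis
        using down[OF pt pt] xy by (intro ge_K[OF near_K near_K])
    qed
    then show "\<exists>B. finite B \<and> (\<forall>x\<in>carrier G. \<forall>y\<in>carrier G.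
       inv\<^bsub>H\<^esub> q x \<otimes>\<^bsub>H\<^esub> q y \<in> C \<longrightarrow> inv\<^bsub>G\<^esub> x \<otimes>\<^bsub>G\<^esub> y \<in> B)"
      using S.word_ball_finite by blast
  next
    \<comment> \<open>The point \<open>x\<close> with \<open>f x\<close> near \<open>h\<close> need
      not be a vertex. It is replaced by a vertex \<open>g\<close> at distance at most 2; both
      \<open>h\<close> and \<open>q g\<close> are then measured from a vertex \<open>y\<close> near
      \<open>f x\<close>, which gives the two factors.\<close>
    let ?D = "m_inv H ` T.word_ball (n + 2) <#>\<^bsub>H\<^esub> T.word_ball (n * 2 + n + 2)"
    have "\<exists>g\<in>carrier G. inv\<^bsub>H\<^esub> h \<otimes>\<^bsub>H\<^esub> q g \<in> ?D" if h: "h \<in> carrier H" for h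
    proof -
      have "vertex_point h \<in> graph_points L" using vertex_near_graph_points[OF near_L[OF h]] .
      then obtain x where x: "x \<in> graph_points K" "graph_dist L (f x) (vertex_point h) \<le> real n"
        using surj unfolding quasi_surjective_def by blast
      obtain g where g: "vertex_near K g x" using G.ex_vertex_near[OF _ SG] x unfolding K_def by blast
      have gG: "g \<in> carrier G" using G.vertex_near_closed[OF SG] g by (simp add: K_def)
      have "graph_dist K x (vertex_point g) \<le> real 2"
        using le_K[OF g near_K[OF gG], of 0] gG S.one_word_ball by simp
      then have d: "graph_dist L (f x) (f (vertex_point g)) \<le> real (n * 2 + n)"
        by (intro up pt gG x)
      have "f x \<in> graph_points L" using f x by auto
      then obtain y where y: "vertex_near L y (f x)" using H.ex_vertex_near[OF _ TH] unfolding L_def by blast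
      have yH: "y \<in> carrier H" using H.vertex_near_closed[OF TH] y by (simp add: L_def)
      have "inv\<^bsub>H\<^esub> y \<otimes>\<^bsub>H\<^esub> h \<in> T.word_ball (n + 2)" using ge_L[OF y near_L[OF h] x(2)] .
      moreover have "inv\<^bsub>H\<^esub> y \<otimes>\<^bsub>H\<^esub> q g \<in> T.word_ball (n * 2 + n + 2)"
        using ge_L[OF y near_q[OF gG] d] .
      ultimately have "inv\<^bsub>H\<^esub> (inv\<^bsub>H\<^esub> y \<otimes>\<^bsub>H\<^esub> h) \<otimes>\<^bsub>H\<^esub> (inv\<^bsub>H\<^esub> y \<otimes>\<^bsub>H\<^esub> q g) \<in> ?D"
        by (intro set_multI imageI)
      moreover have "inv\<^bsub>H\<^esub> (inv\<^bsub>H\<^esub> y \<otimes>\<^bsub>H\<^esub> h) \<otimes>\<^bsub>H\<^esub> (inv\<^bsub>H\<^esub> y \<otimes>\<^bsub>H\<^esub> q g) = inv\<^bsub>H\<^esub> h \<otimes>\<^bsub>H\<^esub> q g"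
        using yH h q_cl[OF gG] by (simp add: H.ldiff_inv H.ldiff_trans)
      ultimately show ?thesis using gG by auto
    qed
    moreover have "finite ?D" by (intro finite_set_mult finite_imageI T.word_ball_finite)
    ultimately show "\<exists>D. finite D \<and> (\<forall>h\<in>carrier H. \<exists>g\<in>carrier G. inv\<^bsub>H\<^esub> h \<otimes>\<^bsub>H\<^esub> q g \<in> D)"
      by blast
  qed
  then show ?thesis using that S.word_group_axioms T.word_group_axioms by blast
qed

text \<open>\<open>p\<close> picks approximate preimages under \<open>q\<close>. The two control
  clauses exchange roles: properness of \<open>q\<close> bounds the spreading of \<open>p\<close>,
  and the control on the spreading of \<open>q\<close> makes \<open>p\<close> proper. Closeness of
  \<open>p\<close> after \<open>q\<close> to the identity gives density.\<close>

lemma coarse_equivalence_inverse: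
  assumes "group G" "group H" "coarse_equivalence G H q"
  obtains p D where "coarse_equivalence H G p" "finite D"
    "\<And>x. x \<in> carrier G \<Longrightarrow> inv\<^bsub>G\<^esub> x \<otimes>\<^bsub>G\<^esub> p (q x) \<in> D"
proof -
  interpret G: group G by fact
  interpret H: group H by fact
  note q_cl = coarse_equivalence_closed[OF assms(3)]
  obtain E where E: "finite E" "\<And>h. h \<in> carrier H \<Longrightarrow> \<exists>g\<in>carrier G. inv\<^bsub>H\<^esub> h \<otimes>\<^bsub>H\<^esub> q g \<in> E"
    using coarse_equivalence_dense[OF assms(3)] by blast
  define p where "p h = (SOME g. g \<in> carrier G \<and> inv\<^bsub>H\<^esub> h \<otimes>\<^bsub>H\<^esub> q g \<in> E)" for h
  have p: "p h \<in> carrier G" "inv\<^bsub>H\<^esub> h \<otimes>\<^bsub>H\<^esub> q (p h) \<in> E" if "h \<in> carrier H" for h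
    using someI_ex[of "\<lambda>g. g \<in> carrier G \<and> inv\<^bsub>H\<^esub> h \<otimes>\<^bsub>H\<^esub> q g \<in> E"] E(2)[OF that]
    unfolding p_def by blast+
  have p': "inv\<^bsub>H\<^esub> q (p h) \<otimes>\<^bsub>H\<^esub> h \<in> m_inv H ` E" if "h \<in> carrier H" for h
    using imageI[OF p(2)[OF that], of "m_inv H"] that p(1) q_cl by (simp add: H.ldiff_inv)
  obtain D where D: "finite D"
    "\<And>x y. x \<in> carrier G \<Longrightarrow> y \<in> carrier G \<Longrightarrow> inv\<^bsub>H\<^esub> q x \<otimes>\<^bsub>H\<^esub> q y \<in> E \<Longrightarrow> inv\<^bsub>G\<^esub> x \<otimes>\<^bsub>G\<^esub> y \<in> D"
    using coarse_equivalence_proper[OF assms(3) E(1)] by blast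
  have close: "inv\<^bsub>G\<^esub> x \<otimes>\<^bsub>G\<^esub> p (q x) \<in> D" if "x \<in> carrier G" for x
    using that p q_cl by (intro D(2)) auto
  have "coarse_equivalence H G p"
    unfolding coarse_equivalence_def
  proof (intro conjI allI impI)
    show "p \<in> carrier H \<rightarrow> carrier G" using p by auto
  next
    fix B :: "'c set" assume "finite B"
    then have "finite (m_inv H ` E <#>\<^bsub>H\<^esub> B <#>\<^bsub>H\<^esub> E)" using E by (intro finite_set_mult) auto
    then obtain C where C: "finite C"
      "\<And>x y. x \<in> carrier G \<Longrightarrow> y \<in> carrier G \<Longrightarrow>
        inv\<^bsub>H\<^esub> q x \<otimes>\<^bsub>H\<^esub> q y \<in> m_inv H ` E <#>\<^bsub>H\<^esub> B <#>\<^bsub>H\<^esub> E \<Longrightarrow> inv\<^bsub>G\<^esub> x \<otimes>\<^bsub>G\<^esub> y \<in> C"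
      using coarse_equivalence_proper[OF assms(3)] by blast
    have "inv\<^bsub>G\<^esub> p x \<otimes>\<^bsub>G\<^esub> p y \<in> C"
      if xy: "x \<in> carrier H" "y \<in> carrier H" "inv\<^bsub>H\<^esub> x \<otimes>\<^bsub>H\<^esub> y \<in> B" for x y
    proof (rule C(2))
      have "(inv\<^bsub>H\<^esub> q (p x) \<otimes>\<^bsub>H\<^esub> x) \<otimes>\<^bsub>H\<^esub> (inv\<^bsub>H\<^esub> x \<otimes>\<^bsub>H\<^esub> y) \<otimes>\<^bsub>H\<^esub> (inv\<^bsub>H\<^esub> y \<otimes>\<^bsub>H\<^esub> q (p y))
          \<in> m_inv H ` E <#>\<^bsub>H\<^esub> B <#>\<^bsub>H\<^esub> E"
        using xy p p' by (intro set_multI)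
      then show "inv\<^bsub>H\<^esub> q (p x) \<otimes>\<^bsub>H\<^esub> q (p y) \<in> m_inv H ` E <#>\<^bsub>H\<^esub> B <#>\<^bsub>H\<^esub> E"
        using xy p q_cl by (simp add: H.ldiff_trans)
    qed (use xy p in auto)
    then show "\<exists>C. finite C \<and> (\<forall>x\<in>carrier H. \<forall>y\<in>carrier H.
       inv\<^bsub>H\<^esub> x \<otimes>\<^bsub>H\<^esub> y \<in> B \<longrightarrow> inv\<^bsub>G\<^esub> p x \<otimes>\<^bsub>G\<^esub> p y \<in> C)" using C(1) by blast
  next
    fix C :: "'a set" assume "finite C"
    then obtain B where B: "finite B"
      "\<And>x y. x \<in> carrier G \<Longrightarrow> y \<in> carrier G \<Longrightarrow> inv\<^bsub>G\<^esub> x \<otimes>\<^bsub>G\<^esub> y \<in> C \<Longrightarrow> inv\<^bsub>H\<^esub> q x \<otimes>\<^bsub>H\<^esub> q y \<in> B"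
      using coarse_equivalence_bornologous[OF assms(3)] by blast
    let ?B = "E <#>\<^bsub>H\<^esub> B <#>\<^bsub>H\<^esub> m_inv H ` E"
    have "inv\<^bsub>H\<^esub> x \<otimes>\<^bsub>H\<^esub> y \<in> ?B"
      if xy: "x \<in> carrier H" "y \<in> carrier H" "inv\<^bsub>G\<^esub> p x \<otimes>\<^bsub>G\<^esub> p y \<in> C" for x y
    proof -
      have "(inv\<^bsub>H\<^esub> x \<otimes>\<^bsub>H\<^esub> q (p x)) \<otimes>\<^bsub>H\<^esub> (inv\<^bsub>H\<^esub> q (p x) \<otimes>\<^bsub>H\<^esub> q (p y)) \<otimes>\<^bsub>H\<^esub> (inv\<^bsub>H\<^esub> q (p y) \<otimes>\<^bsub>H\<^esub> y) \<in> ?B"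
        using xy p p' by (intro set_multI B(2))
      then show ?thesis using xy p q_cl by (simp add: H.ldiff_trans)
    qed
    moreover have "finite ?B" using E B by (intro finite_set_mult) auto
    ultimately show "\<exists>B. finite B \<and> (\<forall>x\<in>carrier H. \<forall>y\<in>carrier H.
       inv\<^bsub>G\<^esub> p x \<otimes>\<^bsub>G\<^esub> p y \<in> C \<longrightarrow> inv\<^bsub>H\<^esub> x \<otimes>\<^bsub>H\<^esub> y \<in> B)" by blast
  next
    show "\<exists>D. finite D \<and> (\<forall>h\<in>carrier G. \<exists>g\<in>carrier H. inv\<^bsub>G\<^esub> h \<otimes>\<^bsub>G\<^esub> p g \<in> D)"
      using D(1) close q_cl by blast
  qed
  then show ?thesis using that D(1) close by blast
qed

section \<open>Invariance of bounded presentations under coarse equivalence\<close>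

definition geodesic_word :: "('a, 'm) monoid_scheme \<Rightarrow> 'a set \<Rightarrow> 'a \<Rightarrow> 'a list" where
  "geodesic_word G S x = arg_min length (\<lambda>w. set w \<subseteq> S \<and> word_prod G w = x)"

context word_group
begin

lemma geodesic_word:
  assumes "x \<in> carrier G"
  shows "set (geodesic_word G S x) \<subseteq> S" "word_prod G (geodesic_word G S x) = x"
proof -
  obtain w where "set w \<subseteq> S \<and> word_prod G w = x" using ex_word[OF assms] by blast
  from arg_min_natI[where P = "\<lambda>w. set w \<subseteq> S \<and> word_prod G w = x" and m = length, OF this]
  show "set (geodesic_word G S x) \<subseteq> S" "word_prod G (geodesic_word G S x) = x"
    unfolding geodesic_word_def by auto
qed

lemma length_geodesic_word:
  assumes "x \<in> word_ball n"
  shows "length (geodesic_word G S x) \<le> n"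
proof -
  obtain w where w: "set w \<subseteq> S \<and> word_prod G w = x" "length w \<le> n"
    using assms unfolding word_ball_def by auto
  from arg_min_nat_le[where P = "\<lambda>w. set w \<subseteq> S \<and> word_prod G w = x" and m = length, OF w(1)] w(2)
  show ?thesis unfolding geodesic_word_def by linarith
qed

end

text \<open>The image of the path that starts at \<open>g\<close> and reads \<open>w\<close>, with
  consecutive image points joined by shortest words. The starting point matters because
  \<open>p\<close> is no homomorphism.\<close>

primrec push_word ::
    "('a, 'm) monoid_scheme \<Rightarrow> ('b, 'n) monoid_scheme \<Rightarrow> 'b set \<Rightarrow> ('a \<Rightarrow> 'b) \<Rightarrow> 'a list \<Rightarrow> 'a \<Rightarrow> 'b list" where
  "push_word G H T p [] g = []"
| "push_word G H T p (s # w) g =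
    geodesic_word H T (inv\<^bsub>H\<^esub> p g \<otimes>\<^bsub>H\<^esub> p (g \<otimes>\<^bsub>G\<^esub> s)) @ push_word G H T p w (g \<otimes>\<^bsub>G\<^esub> s)"

locale word_group_map = G: word_group G S + H: word_group H T
  for G :: "('a, 'm) monoid_scheme" and S and H :: "('b, 'n) monoid_scheme" and T +
  fixes p :: "'a \<Rightarrow> 'b"
  assumes p_closed: "g \<in> carrier G \<Longrightarrow> p g \<in> carrier H"
begin

abbreviation "push \<equiv> push_word G H T p"

lemma push_set: "set w \<subseteq> S \<Longrightarrow> g \<in> carrier G \<Longrightarrow> set (push w g) \<subseteq> T"
proof (induction w arbitrary: g)
  case (Cons s w)
  then have "s \<in> carrier G" using G.S_closed by auto
  then show ?case
    using Cons.IH[of "g \<otimes>\<^bsub>G\<^esub> s"] Cons.prems H.geodesic_word(1) p_closed by simp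
qed simp

lemma push_prod:
  "set w \<subseteq> S \<Longrightarrow> g \<in> carrier G \<Longrightarrow>
    word_prod H (push w g) = inv\<^bsub>H\<^esub> p g \<otimes>\<^bsub>H\<^esub> p (g \<otimes>\<^bsub>G\<^esub> word_prod G w)"
proof (induction w arbitrary: g)
  case (Cons s w)
  then have s: "s \<in> carrier G" using G.S_closed by auto
  have "word_prod H (push (s # w) g) =
      (inv\<^bsub>H\<^esub> p g \<otimes>\<^bsub>H\<^esub> p (g \<otimes>\<^bsub>G\<^esub> s)) \<otimes>\<^bsub>H\<^esub> (inv\<^bsub>H\<^esub> p (g \<otimes>\<^bsub>G\<^esub> s) \<otimes>\<^bsub>H\<^esub> p (g \<otimes>\<^bsub>G\<^esub> s \<otimes>\<^bsub>G\<^esub> word_prod G w))"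
    using Cons s p_closed H.geodesic_word push_set by (simp add: H.word_append)
  also have "\<dots> = inv\<^bsub>H\<^esub> p g \<otimes>\<^bsub>H\<^esub> p (g \<otimes>\<^bsub>G\<^esub> s \<otimes>\<^bsub>G\<^esub> word_prod G w)"
    using Cons.prems s p_closed G.word_closed by (intro H.ldiff_trans) auto
  finally show ?case using Cons.prems s G.word_closed by (simp add: G.m_assoc)
qed (simp add: p_closed)

lemma push_append:
  "set u \<subseteq> S \<Longrightarrow> g \<in> carrier G \<Longrightarrow> push (u @ v) g = push u g @ push v (g \<otimes>\<^bsub>G\<^esub> word_prod G u)"
proof (induction u arbitrary: g)
  case (Cons s u)
  then have s: "s \<in> carrier G" using G.S_closed by auto
  then show ?case using Cons G.word_closed[of u] by (simp add: G.m_assoc)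
qed simp

lemma length_push:
  assumes c: "\<And>g s. g \<in> carrier G \<Longrightarrow> s \<in> S \<Longrightarrow> inv\<^bsub>H\<^esub> p g \<otimes>\<^bsub>H\<^esub> p (g \<otimes>\<^bsub>G\<^esub> s) \<in> H.word_ball c"
  shows "set w \<subseteq> S \<Longrightarrow> g \<in> carrier G \<Longrightarrow> length (push w g) \<le> c * length w"
proof (induction w arbitrary: g)
  case (Cons s w)
  then have s: "s \<in> carrier G" using G.S_closed by auto
  have "length (push w (g \<otimes>\<^bsub>G\<^esub> s)) \<le> c * length w" using Cons s by simp
  moreover have "length (geodesic_word H T (inv\<^bsub>H\<^esub> p g \<otimes>\<^bsub>H\<^esub> p (g \<otimes>\<^bsub>G\<^esub> s))) \<le> c"
    using Cons.prems by (intro H.length_geodesic_word c) auto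
  ultimately show ?case by simp
qed simp

text \<open>Both sides of a replacement end at the same element of \<open>G\<close>, so the pushed
  pieces have equal value and length at most \<open>c * N\<close>, and whatever follows is pushed
  from the same base point.\<close>

lemma push_word_eq:
  assumes c: "\<And>g s. g \<in> carrier G \<Longrightarrow> s \<in> S \<Longrightarrow> inv\<^bsub>H\<^esub> p g \<otimes>\<^bsub>H\<^esub> p (g \<otimes>\<^bsub>G\<^esub> s) \<in> H.word_ball c"
    and g: "g \<in> carrier G" and M: "c * N \<le> M" and eq: "word_eq G S N w w'"
  shows "word_eq H T M (push w g) (push w' g)"
  using eq unfolding word_eq_def[of G]
proof (induction rule: rtranclp_induct)
  case (step y z)
  from step.hyps(2) have "word_eq H T M (push y g) (push z g)"
  proof cases
    case (word_stepI u v r r')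
    define a where "a = g \<otimes>\<^bsub>G\<^esub> word_prod G u"
    have a: "a \<in> carrier G" using g word_stepI G.word_closed by (simp add: a_def)
    have len: "length (push x a) \<le> M" if "set x \<subseteq> S" "length x \<le> N" for x
      using length_push[OF c that(1) a] mult_le_mono2[OF that(2), of c] M by linarith
    have "word_eq H T M (push r a) (push r' a)"
      using word_stepI a push_set push_prod by (intro word_eq_bounded len) auto
    then have "word_eq H T M (push u g @ push r a @ push v (a \<otimes>\<^bsub>G\<^esub> word_prod G r))
        (push u g @ push r' a @ push v (a \<otimes>\<^bsub>G\<^esub> word_prod G r))"
      using word_stepI g a G.word_closed by (intro word_eq_context push_set) auto
    then show ?thesis
      using word_stepI g a by (simp add: push_append a_def)
  qed
  with step.IH show ?case by (rule word_eq_trans)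
qed simp

end

text \<open>Applied to generators to bound pushed words, and to a whole ball to bound the alphabet
  of the subshift.\<close>

lemma coarse_equivalence_step_bound:
  assumes "word_group G S" "word_group H T" "coarse_equivalence G H p" "finite B" "B \<subseteq> carrier G"
  obtains c where
    "\<And>g s. g \<in> carrier G \<Longrightarrow> s \<in> B \<Longrightarrow>
      inv\<^bsub>H\<^esub> p g \<otimes>\<^bsub>H\<^esub> p (g \<otimes>\<^bsub>G\<^esub> s) \<in> word_group.word_ball H T c"
proof -
  interpret G: word_group G S by fact
  interpret H: word_group H T by fact
  note p_cl = coarse_equivalence_closed[OF assms(3)]
  obtain C where C: "finite C"
    "\<And>x y. x \<in> carrier G \<Longrightarrow> y \<in> carrier G \<Longrightarrow> inv\<^bsub>G\<^esub> x \<otimes>\<^bsub>G\<^esub> y \<in> B \<Longrightarrow> inv\<^bsub>H\<^esub> p x \<otimes>\<^bsub>H\<^esub> p y \<in> C"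
    using coarse_equivalence_bornologous[OF assms(3,4)] by blast
  obtain c where c: "C \<inter> carrier H \<subseteq> H.word_ball c"
    using H.finite_subset_word_ball[of "C \<inter> carrier H"] C by auto
  have "inv\<^bsub>H\<^esub> p g \<otimes>\<^bsub>H\<^esub> p (g \<otimes>\<^bsub>G\<^esub> s) \<in> H.word_ball c" if "g \<in> carrier G" "s \<in> B" for g s
  proof -
    have s: "s \<in> carrier G" using that assms(5) by auto
    then have "inv\<^bsub>H\<^esub> p g \<otimes>\<^bsub>H\<^esub> p (g \<otimes>\<^bsub>G\<^esub> s) \<in> C"
      using that by (intro C(2)) (auto simp: G.ldiff_mult)
    then show ?thesis using c s that p_cl by auto
  qed
  then show ?thesis using that by blast
qed

text \<open>A word \<open>w\<close> in \<open>H\<close> is pushed to \<open>G\<close> and back,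
  giving \<open>z w\<close>. Equal-valued words become homotopic in \<open>G\<close> at scale
  \<open>N\<close>, and \<open>p\<close> carries the homotopy back. The word \<open>w\<close> itself
  is linked with \<open>z w\<close> by a ladder of bounded squares (\<open>key\<close>), whose rung
  \<open>v x\<close> joins \<open>x\<close> to \<open>p (q x)\<close>.\<close>

lemma boundedly_presented_coarse_equivalence:
  assumes G: "word_group G S" and H: "word_group H T" and N: "boundedly_presented G S N"
    and q: "coarse_equivalence H G q" and p: "coarse_equivalence G H p"
    and D: "finite D" "\<And>h. h \<in> carrier H \<Longrightarrow> inv\<^bsub>H\<^esub> h \<otimes>\<^bsub>H\<^esub> p (q h) \<in> D"
  obtains M where "boundedly_presented H T M"
proof -
  interpret G: word_group G S by fact
  interpret H: word_group H T by fact
  note p_cl = coarse_equivalence_closed[OF p] and q_cl = coarse_equivalence_closed[OF q]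
  interpret p: word_group_map G S H T p by unfold_locales (rule p_cl)
  interpret q: word_group_map H T G S q by unfold_locales (rule q_cl)
  obtain c where c: "\<And>g s. g \<in> carrier G \<Longrightarrow> s \<in> S \<Longrightarrow>
      inv\<^bsub>H\<^esub> p g \<otimes>\<^bsub>H\<^esub> p (g \<otimes>\<^bsub>G\<^esub> s) \<in> H.word_ball c"
    using coarse_equivalence_step_bound[OF G H p G.fin_S G.S_closed] by blast
  obtain c' where c': "\<And>h t. h \<in> carrier H \<Longrightarrow> t \<in> T \<Longrightarrow>
      inv\<^bsub>G\<^esub> q h \<otimes>\<^bsub>G\<^esub> q (h \<otimes>\<^bsub>H\<^esub> t) \<in> G.word_ball c'"
    using coarse_equivalence_step_bound[OF H G q H.fin_S H.S_closed] by blast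
  obtain d where d: "D \<inter> carrier H \<subseteq> H.word_ball d"
    using H.finite_subset_word_ball[of "D \<inter> carrier H"] D by auto
  obtain e where e: "m_inv H ` H.word_ball d \<subseteq> H.word_ball e"
    using H.finite_subset_word_ball[of "m_inv H ` H.word_ball d"] H.word_ball_finite H.word_ball_closed
    by (meson H.inv_closed finite_imageI image_subsetI subsetD)
  \<comment> \<open>\<open>c * N\<close> is for pushed relations, 1 + d and d + c c' for the two
    sides of a square of the ladder, and d + e for a rung followed by its inverse.\<close>
  define M where "M = Suc (c * N + d + e + c * c')"
  let ?eq = "word_eq H T M"
  define v where "v x = geodesic_word H T (inv\<^bsub>H\<^esub> x \<otimes>\<^bsub>H\<^esub> p (q x))" for x
  define z where "z w x = p.push (q.push w x) (q x)" for w x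
  have ball_d: "inv\<^bsub>H\<^esub> x \<otimes>\<^bsub>H\<^esub> p (q x) \<in> H.word_ball d" if "x \<in> carrier H" for x
    using D(2)[OF that] d that p_cl q_cl by auto
  have v: "set (v x) \<subseteq> T" "word_prod H (v x) = inv\<^bsub>H\<^esub> x \<otimes>\<^bsub>H\<^esub> p (q x)" "length (v x) \<le> d"
    if "x \<in> carrier H" for x
    unfolding v_def using that p_cl q_cl ball_d by (auto intro!: H.geodesic_word H.length_geodesic_word dest: subsetD[OF H.geodesic_word(1), rotated])
  have z: "set (z w x) \<subseteq> T"
    "word_prod H (z w x) = inv\<^bsub>H\<^esub> p (q x) \<otimes>\<^bsub>H\<^esub> p (q (x \<otimes>\<^bsub>H\<^esub> word_prod H w))"
    if "x \<in> carrier H" "set w \<subseteq> T" for x w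
    unfolding z_def using that q_cl p_cl q.push_set H.word_closed
    by (simp_all add: p.push_set p.push_prod q.push_prod G.mult_ldiff)
  have z_Cons: "z (t # w) x = z [t] x @ z w (x \<otimes>\<^bsub>H\<^esub> t)"
    if "x \<in> carrier H" "t \<in> T" "set w \<subseteq> T" for t w x
  proof -
    have t: "t \<in> carrier H" using that H.S_closed by auto
    have "z ([t] @ w) x = p.push (q.push [t] x @ q.push w (x \<otimes>\<^bsub>H\<^esub> t)) (q x)"
      unfolding z_def using that t by (subst q.push_append) auto
    also have "\<dots> = z [t] x @ p.push (q.push w (x \<otimes>\<^bsub>H\<^esub> t)) (q x \<otimes>\<^bsub>G\<^esub> word_prod G (q.push [t] x))"
      unfolding z_def using that q_cl q.push_set[of "[t]" x] by (intro p.push_append) auto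
    also have "q x \<otimes>\<^bsub>G\<^esub> word_prod G (q.push [t] x) = q (x \<otimes>\<^bsub>H\<^esub> t)"
      using that t q_cl by (subst q.push_prod) (auto simp: G.mult_ldiff)
    finally show ?thesis by (simp add: z_def)
  qed
  have z_len: "length (z [t] x) \<le> c * c'" if "x \<in> carrier H" "t \<in> T" for x t
  proof -
    have "length (z [t] x) \<le> c * length (q.push [t] x)"
      unfolding z_def using that q.push_set[of "[t]" x] q_cl by (intro p.length_push c) auto
    also have "\<dots> \<le> c * c'" using q.length_push[OF c', of "[t]" x] that by (intro mult_le_mono2) auto
    finally show ?thesis .
  qed
  have key: "?eq (w @ v (x \<otimes>\<^bsub>H\<^esub> word_prod H w)) (v x @ z w x)"
    if "x \<in> carrier H" "set w \<subseteq> T" for x w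
    using that
  proof (induction w arbitrary: x)
    case (Cons t w)
    then have t: "t \<in> T" "t \<in> carrier H" and w: "set w \<subseteq> T" using H.S_closed by auto
    let ?y = "x \<otimes>\<^bsub>H\<^esub> t"
    have y: "?y \<in> carrier H" using t Cons.prems by simp
    have "?eq ([t] @ (w @ v (?y \<otimes>\<^bsub>H\<^esub> word_prod H w)) @ []) ([t] @ (v ?y @ z w ?y) @ [])"
      using t by (intro word_eq_context Cons.IH y w) auto
    moreover have "?eq ([t] @ v ?y) (v x @ z [t] x)"
    proof (rule word_eq_bounded)
      have "word_prod H ([t] @ v ?y) = (inv\<^bsub>H\<^esub> x \<otimes>\<^bsub>H\<^esub> ?y) \<otimes>\<^bsub>H\<^esub> (inv\<^bsub>H\<^esub> ?y \<otimes>\<^bsub>H\<^esub> p (q ?y))"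
        using v[OF y] t Cons.prems(1) by (simp add: H.ldiff_mult)
      also have "\<dots> = (inv\<^bsub>H\<^esub> x \<otimes>\<^bsub>H\<^esub> p (q x)) \<otimes>\<^bsub>H\<^esub> (inv\<^bsub>H\<^esub> p (q x) \<otimes>\<^bsub>H\<^esub> p (q ?y))"
        using y Cons.prems(1) p_cl q_cl by (simp add: H.ldiff_trans)
      also have "\<dots> = word_prod H (v x @ z [t] x)"
        using v[OF Cons.prems(1)] z[OF Cons.prems(1), of "[t]"] t by (simp add: H.word_append)
      finally show "word_prod H ([t] @ v ?y) = word_prod H (v x @ z [t] x)" .
      show "length ([t] @ v ?y) \<le> M" "length (v x @ z [t] x) \<le> M"
        using v(3)[OF y] v(3)[OF Cons.prems(1)] z_len[OF Cons.prems(1) t(1)] by (auto simp: M_def)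
    qed (use v[OF y] v[OF Cons.prems(1)] z[OF Cons.prems(1), of "[t]"] t in auto)
    then have "?eq ([] @ ([t] @ v ?y) @ z w ?y) ([] @ (v x @ z [t] x) @ z w ?y)"
      using z(1)[OF y w] by (intro word_eq_context) auto
    ultimately have "?eq (t # w @ v (?y \<otimes>\<^bsub>H\<^esub> word_prod H w)) (v x @ z [t] x @ z w ?y)"
      by (auto intro: word_eq_trans)
    moreover have "?y \<otimes>\<^bsub>H\<^esub> word_prod H w = x \<otimes>\<^bsub>H\<^esub> word_prod H (t # w)"
      using t Cons.prems w H.word_closed by (simp add: H.m_assoc)
    ultimately show ?case using z_Cons[of x t w] Cons.prems t w by simp
  qed (simp add: z_def)
  have "boundedly_presented H T M"
    unfolding boundedly_presented_def
  proof (intro allI impI)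
    fix w w' assume w: "set w \<subseteq> T" "set w' \<subseteq> T" "word_prod H w = word_prod H w'"
    let ?o = "\<one>\<^bsub>H\<^esub>" and ?x = "word_prod H w"
    have x: "?x \<in> carrier H" using w H.word_closed by simp
    have "word_eq G S N (q.push w ?o) (q.push w' ?o)"
      using N w q.push_set q.push_prod unfolding boundedly_presented_def by simp
    then have "?eq (z w ?o) (z w' ?o)"
      unfolding z_def using q_cl c by (intro p.push_word_eq[of c]) (auto simp: M_def)
    then have "?eq (v ?o @ z w ?o @ []) (v ?o @ z w' ?o @ [])"
      using v(1)[of ?o] by (intro word_eq_context) auto
    then have "?eq (w @ v ?x) (w' @ v ?x)"
      using key[of ?o w] key[of ?o w'] w x by (auto intro: word_eq_sym word_eq_trans)
    \<comment> \<open>\<open>r\<close> spells the inverse of the last rung, which allows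
      \<open>v ?x\<close> to be cancelled from both sides.\<close>
    moreover define r where "r = geodesic_word H T (inv\<^bsub>H\<^esub> (inv\<^bsub>H\<^esub> ?x \<otimes>\<^bsub>H\<^esub> p (q ?x)))"
    have rc: "inv\<^bsub>H\<^esub> (inv\<^bsub>H\<^esub> ?x \<otimes>\<^bsub>H\<^esub> p (q ?x)) \<in> carrier H" using x p_cl q_cl by simp
    have r: "set r \<subseteq> T" "word_prod H r = inv\<^bsub>H\<^esub> (inv\<^bsub>H\<^esub> ?x \<otimes>\<^bsub>H\<^esub> p (q ?x))" "length r \<le> e"
      unfolding r_def using H.geodesic_word[OF rc] H.length_geodesic_word ball_d[OF x] e by auto
    ultimately have "?eq (w @ v ?x @ r) (w' @ v ?x @ r)"
      using word_eq_context[of H T M "w @ v ?x" "w' @ v ?x" "[]" r] by simp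
    moreover have "?eq (v ?x @ r) []"
      using v[OF x] r x p_cl q_cl by (intro word_eq_bounded) (auto simp: M_def H.word_append)
    then have "?eq (u @ v ?x @ r) u" if "set u \<subseteq> T" for u
      using word_eq_context[of H T M "v ?x @ r" "[]" u "[]"] that by simp
    ultimately show "?eq w w'" using w by (meson word_eq_sym word_eq_trans)
  qed
  with that show ?thesis by blast
qed

section \<open>Subshifts of finite type\<close>

context group
begin

lemma shift_shift:
  "a \<in> carrier G \<Longrightarrow> b \<in> carrier G \<Longrightarrow> shift G a (shift G b \<sigma>) = shift G (b \<otimes> a) \<sigma>"
  by (auto simp: shift_def m_assoc intro!: restrict_ext)

lemma shift_one: "\<sigma> \<in> carrier G \<rightarrow>\<^sub>E A \<Longrightarrow> shift G \<one> \<sigma> = \<sigma>"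
  by (auto simp: shift_def fun_eq_iff PiE_def extensional_def)

lemma shift_PiE: "\<sigma> \<in> carrier G \<rightarrow>\<^sub>E A \<Longrightarrow> g \<in> carrier G \<Longrightarrow> shift G g \<sigma> \<in> carrier G \<rightarrow>\<^sub>E A"
  by (auto simp: shift_def PiE_def Pi_def)

lemma shift_inv:
  "\<sigma> \<in> carrier G \<rightarrow>\<^sub>E A \<Longrightarrow> g \<in> carrier G \<Longrightarrow> shift G g (shift G (inv g) \<sigma>) = \<sigma>"
  "\<sigma> \<in> carrier G \<rightarrow>\<^sub>E A \<Longrightarrow> g \<in> carrier G \<Longrightarrow> shift G (inv g) (shift G g \<sigma>) = \<sigma>"
  by (simp_all add: shift_shift shift_one)

text \<open>The intersection in \<open>subshift_of_finite_type\<close> read from a single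
  configuration: it lies in the image under the shift by \<open>g\<close> exactly when its shift by
  the inverse of \<open>g\<close> satisfies the condition, and \<open>g\<close> runs through a
  group.\<close>

definition allowed_configs :: "'a set \<Rightarrow> 'c set \<Rightarrow> ('a \<Rightarrow> 'c) set \<Rightarrow> ('a \<Rightarrow> 'c) set" where
  "allowed_configs K A L = {\<sigma> \<in> carrier G \<rightarrow>\<^sub>E A. \<forall>g\<in>carrier G. restrict (shift G g \<sigma>) K \<in> L}"

lemma subshift_of_finite_type_allowed_configs:
  assumes "finite K" "K \<subseteq> carrier G" "L \<subseteq> (K \<rightarrow>\<^sub>E A)"
  shows "subshift_of_finite_type G A (allowed_configs K A L)"
proof -
  let ?C = "{\<sigma> \<in> carrier G \<rightarrow>\<^sub>E A. restrict \<sigma> K \<in> L}"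
  have "allowed_configs K A L = (\<Inter>g\<in>carrier G. shift G g ` ?C)"
  proof (intro equalityI subsetI INT_I)
    fix \<sigma> g assume \<sigma>: "\<sigma> \<in> allowed_configs K A L" and g: "g \<in> carrier G"
    then have "shift G (inv g) \<sigma> \<in> ?C" using shift_PiE[of \<sigma> A "inv g"] by (simp add: allowed_configs_def)
    moreover have "\<sigma> = shift G g (shift G (inv g) \<sigma>)"
      using \<sigma> g by (auto simp: allowed_configs_def shift_inv)
    ultimately show "\<sigma> \<in> shift G g ` ?C" by blast
  next
    fix \<sigma> assume \<sigma>: "\<sigma> \<in> (\<Inter>g\<in>carrier G. shift G g ` ?C)"
    then have "\<sigma> \<in> shift G \<one> ` ?C" by blast
    then have \<sigma>A: "\<sigma> \<in> carrier G \<rightarrow>\<^sub>E A" by (auto simp: shift_one)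
    have "restrict (shift G g \<sigma>) K \<in> L" if g: "g \<in> carrier G" for g
    proof -
      have "\<sigma> \<in> shift G (inv g) ` ?C" using \<sigma> g by blast
      then obtain \<tau> where "\<tau> \<in> ?C" "\<sigma> = shift G (inv g) \<tau>" by blast
      then show ?thesis using g shift_inv(1)[of \<tau> A g] by auto
    qed
    with \<sigma>A show "\<sigma> \<in> allowed_configs K A L" by (simp add: allowed_configs_def)
  qed
  with assms show ?thesis unfolding subshift_of_finite_type_def by blast
qed

text \<open>A forbidden pattern at \<open>g\<close> is visible on the finite set gK, so fixing these
  coordinates gives an open neighbourhood in the complement. Invariance holds because translates of
  a translate are again translates.\<close>

lemma subshift_allowed_configs:
  assumes "finite K" "K \<subseteq> carrier G"
  shows "subshift G A (allowed_configs K A L)"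
  unfolding subshift_def
proof
  let ?T = "product_topology (\<lambda>_. discrete_topology A) (carrier G)"
  have top: "topspace ?T = carrier G \<rightarrow>\<^sub>E A" by simp
  have "\<exists>U. openin ?T U \<and> \<sigma> \<in> U \<and> U \<subseteq> topspace ?T - allowed_configs K A L"
    if notin: "\<sigma> \<in> topspace ?T - allowed_configs K A L" for \<sigma>
  proof -
    have \<sigma>: "\<sigma> \<in> carrier G \<rightarrow>\<^sub>E A" using notin by simp
    then obtain g where g: "g \<in> carrier G" "restrict (shift G g \<sigma>) K \<notin> L"
      using notin by (auto simp: allowed_configs_def)
    define B where "B x = (if x \<in> (\<lambda>k. g \<otimes> k) ` K then {\<sigma> x} else A)" for x
    have "openin ?T (PiE (carrier G) B)"
      unfolding openin_PiE_gen
    proof (intro disjI2 conjI ballI)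
      have "{i \<in> carrier G. B i \<noteq> topspace (discrete_topology A)} \<subseteq> (\<lambda>k. g \<otimes> k) ` K"
        by (auto simp: B_def split: if_splits)
      then show "finite {i \<in> carrier G. B i \<noteq> topspace (discrete_topology A)}"
        using assms(1) finite_subset by blast
      show "openin (discrete_topology A) (B i)" if "i \<in> carrier G" for i
        using \<sigma> that by (auto simp: B_def)
    qed
    moreover have "\<sigma> \<in> PiE (carrier G) B" using \<sigma> by (auto simp: B_def PiE_iff)
    moreover have "PiE (carrier G) B \<subseteq> topspace ?T - allowed_configs K A L"
    proof
      fix \<tau> assume \<tau>: "\<tau> \<in> PiE (carrier G) B"
      have "B x \<subseteq> A" if "x \<in> carrier G" for x using \<sigma> that by (auto simp: B_def)
      then have "\<tau> \<in> topspace ?T" using \<tau> unfolding top by (auto simp: PiE_iff)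
      moreover have "restrict (shift G g \<tau>) K = restrict (shift G g \<sigma>) K"
      proof (rule restrict_ext)
        fix k assume k: "k \<in> K"
        then have "\<tau> (g \<otimes> k) \<in> B (g \<otimes> k)" using \<tau> assms(2) g by (auto simp: PiE_iff)
        then show "shift G g \<tau> k = shift G g \<sigma> k" using k assms(2) by (auto simp: B_def shift_def)
      qed
      then have "\<tau> \<notin> allowed_configs K A L" using g unfolding allowed_configs_def by force
      ultimately show "\<tau> \<in> topspace ?T - allowed_configs K A L" by simp
    qed
    ultimately show ?thesis by blast
  qed
  then have "openin ?T (topspace ?T - allowed_configs K A L)"
    by (subst openin_subopen) blast
  then show "closedin ?T (allowed_configs K A L)"
    by (auto simp: closedin_def allowed_configs_def)
  have "shift G h \<sigma> \<in> allowed_configs K A L" if "h \<in> carrier G" "\<sigma> \<in> allowed_configs K A L" for h \<sigma>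
    using that shift_PiE[of \<sigma> A h] by (simp add: allowed_configs_def shift_shift)
  then show "\<forall>h\<in>carrier G. shift G h ` allowed_configs K A L \<subseteq> allowed_configs K A L" by blast
qed

text \<open>The configurations all of whose patterns occur in \<open>\<Delta>\<close> form a nonempty subshift of finite type.\<close>

lemma periodic_local_copy:
  assumes "\<not> has_weakly_aperiodic_SFT G"
    and K: "finite K" "K \<subseteq> carrier G" and \<Delta>: "finite (\<Delta> ` carrier G)"
  obtains \<delta> G\<^sub>0 where "finite_index G G\<^sub>0"
    "\<And>a g. a \<in> G\<^sub>0 \<Longrightarrow> g \<in> carrier G \<Longrightarrow> \<delta> (a \<otimes> g) = \<delta> g"
    "\<And>g. g \<in> carrier G \<Longrightarrow> \<exists>g'\<in>carrier G. \<forall>k\<in>K. \<delta> (g \<otimes> k) = \<Delta> (g' \<otimes> k)"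
proof -
  \<comment> \<open>The values of \<open>\<Delta>\<close> have arbitrary type, whereas alphabets
    consist of natural numbers.\<close>
  obtain enc :: "_ \<Rightarrow> nat" where enc: "inj_on enc (\<Delta> ` carrier G)"
    using finite_imp_inj_to_nat_seg[OF \<Delta>] by blast
  define A where "A = enc ` \<Delta> ` carrier G"
  define \<sigma>\<^sub>0 where "\<sigma>\<^sub>0 = (\<lambda>g\<in>carrier G. enc (\<Delta> g))"
  define L where "L = (\<lambda>g. restrict (shift G g \<sigma>\<^sub>0) K) ` carrier G"
  let ?X = "allowed_configs K A L"
  have \<sigma>\<^sub>0: "\<sigma>\<^sub>0 \<in> carrier G \<rightarrow>\<^sub>E A" by (auto simp: \<sigma>\<^sub>0_def A_def)
  have "L \<subseteq> (K \<rightarrow>\<^sub>E A)"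
    unfolding L_def using shift_PiE[OF \<sigma>\<^sub>0] K(2) by (fastforce simp: PiE_iff)
  then have "subshift_of_finite_type G A ?X"
    using K by (intro subshift_of_finite_type_allowed_configs)
  moreover have "subshift G A ?X" using K by (rule subshift_allowed_configs)
  moreover have "\<sigma>\<^sub>0 \<in> ?X" using \<sigma>\<^sub>0 by (auto simp: allowed_configs_def L_def)
  moreover have "finite A" using \<Delta> by (simp add: A_def)
  ultimately obtain \<sigma> where \<sigma>: "\<sigma> \<in> ?X" "finite_index G (stabilizer G (shift G) \<sigma>)"
    using assms(1) unfolding has_weakly_aperiodic_SFT_def weakly_aperiodic_def by blast
  define \<delta> where "\<delta> g = inv_into (\<Delta> ` carrier G) enc (\<sigma> g)" for g
  show ?thesis
  proof (rule that[OF \<sigma>(2)])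
    fix a g assume "a \<in> stabilizer G (shift G) \<sigma>" and g: "g \<in> carrier G"
    then have "shift G a \<sigma> g = \<sigma> g" by (simp add: stabilizer_def)
    then show "\<delta> (a \<otimes> g) = \<delta> g" using g by (simp add: \<delta>_def shift_def)
  next
    fix g assume g: "g \<in> carrier G"
    then have "restrict (shift G g \<sigma>) K \<in> L" using \<sigma> by (simp add: allowed_configs_def)
    then obtain g' where g': "g' \<in> carrier G" "restrict (shift G g \<sigma>) K = restrict (shift G g' \<sigma>\<^sub>0) K"
      by (auto simp: L_def)
    have "\<delta> (g \<otimes> k) = \<Delta> (g' \<otimes> k)" if k: "k \<in> K" for k
    proof -
      have kG: "k \<in> carrier G" using k K by auto
      have "\<sigma> (g \<otimes> k) = enc (\<Delta> (g' \<otimes> k))"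
        using fun_cong[OF g'(2), of k] k kG g g'(1) by (simp add: shift_def \<sigma>\<^sub>0_def)
      then show ?thesis using enc kG g'(1) by (simp add: \<delta>_def)
    qed
    with g' show "\<exists>g'\<in>carrier G. \<forall>k\<in>K. \<delta> (g \<otimes> k) = \<Delta> (g' \<otimes> k)" by blast
  qed
qed

end

section \<open>Integration of local data\<close>

text \<open>Equivalently, \<open>f\<close> on gK is a left translate of \<open>p\<close> on g'K;
  writing it with differences avoids naming the translation.\<close>

definition locally_like ::
    "('a, 'm) monoid_scheme \<Rightarrow> ('b, 'n) monoid_scheme \<Rightarrow> 'a set \<Rightarrow> ('a \<Rightarrow> 'b) \<Rightarrow> ('a \<Rightarrow> 'b) \<Rightarrow> bool" where
  "locally_like G H K f p \<longleftrightarrow> (\<forall>g\<in>carrier G. \<exists>g'\<in>carrier G. \<forall>k\<in>K.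
     inv\<^bsub>H\<^esub> f g \<otimes>\<^bsub>H\<^esub> f (g \<otimes>\<^bsub>G\<^esub> k) = inv\<^bsub>H\<^esub> p g' \<otimes>\<^bsub>H\<^esub> p (g' \<otimes>\<^bsub>G\<^esub> k))"

text \<open>The line integral of the differences \<open>\<delta>\<close> along the path from
  \<open>g\<close> that reads \<open>w\<close>.\<close>

primrec path_prod ::
    "('a, 'm) monoid_scheme \<Rightarrow> ('b, 'n) monoid_scheme \<Rightarrow> ('a \<Rightarrow> 'a \<Rightarrow> 'b) \<Rightarrow> 'a list \<Rightarrow> 'a \<Rightarrow> 'b" where
  "path_prod G H \<delta> [] g = \<one>\<^bsub>H\<^esub>"
| "path_prod G H \<delta> (s # w) g = \<delta> g s \<otimes>\<^bsub>H\<^esub> path_prod G H \<delta> w (g \<otimes>\<^bsub>G\<^esub> s)"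

text \<open>On each ball \<open>\<delta>\<close> is the derivative of \<open>p\<close> near some g',
  so two words of length at most \<open>N\<close> with equal value have equal integrals. The bounded
  presentation of \<open>G\<close> extends this to all words, and \<open>f\<close> is the integral
  from the identity.\<close>

lemma integrate_local_data:
  assumes G: "word_group G S" and N: "boundedly_presented G S N" and H: "group H"
    and p: "\<And>g. g \<in> carrier G \<Longrightarrow> p g \<in> carrier H"
    and M: "N \<le> M" "1 \<le> M"
    and \<delta>: "\<And>g. g \<in> carrier G \<Longrightarrow> \<exists>g'\<in>carrier G. \<forall>k\<in>word_group.word_ball G S M.
      \<forall>l\<in>word_group.word_ball G S M.
      \<delta> (g \<otimes>\<^bsub>G\<^esub> k) l = inv\<^bsub>H\<^esub> p (g' \<otimes>\<^bsub>G\<^esub> k) \<otimes>\<^bsub>H\<^esub> p (g' \<otimes>\<^bsub>G\<^esub> k \<otimes>\<^bsub>G\<^esub> l)"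
    and G\<^sub>0: "G\<^sub>0 \<subseteq> carrier G"
      "\<And>a g. a \<in> G\<^sub>0 \<Longrightarrow> g \<in> carrier G \<Longrightarrow> \<delta> (a \<otimes>\<^bsub>G\<^esub> g) = \<delta> g"
  obtains f where "f \<in> carrier G \<rightarrow> carrier H"
    "locally_like G H (word_group.word_ball G S M) f p"
    "\<And>a g. a \<in> G\<^sub>0 \<Longrightarrow> g \<in> carrier G \<Longrightarrow> f (a \<otimes>\<^bsub>G\<^esub> g) = f a \<otimes>\<^bsub>H\<^esub> f g"
proof -
  interpret G: word_group G S by fact
  interpret H: group H by fact
  let ?F = "path_prod G H \<delta>"
  have S_ball: "s \<in> G.word_ball 1" if "s \<in> S" for s
    using that G.S_closed unfolding G.word_ball_def by (intro CollectI exI[of _ "[s]"]) auto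
  \<comment> \<open>The base point \<open>k\<close> and its radius \<open>m\<close> vary so that the
    induction can advance along the word; \<open>m + length w \<le> M\<close> keeps the path in the
    ball on which one copy of \<open>p\<close> describes \<open>\<delta>\<close>.\<close>
  have local: "\<exists>g'\<in>carrier G. \<forall>w k m. set w \<subseteq> S \<longrightarrow> k \<in> G.word_ball m \<longrightarrow> m + length w \<le> M \<longrightarrow>
      ?F w (g \<otimes>\<^bsub>G\<^esub> k) = inv\<^bsub>H\<^esub> p (g' \<otimes>\<^bsub>G\<^esub> k) \<otimes>\<^bsub>H\<^esub> p (g' \<otimes>\<^bsub>G\<^esub> k \<otimes>\<^bsub>G\<^esub> word_prod G w)"
    if g: "g \<in> carrier G" for g
  proof -
    obtain g' where g': "g' \<in> carrier G" and \<delta>': "\<And>k l. k \<in> G.word_ball M \<Longrightarrow> l \<in> G.word_ball M \<Longrightarrow>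
      \<delta> (g \<otimes>\<^bsub>G\<^esub> k) l = inv\<^bsub>H\<^esub> p (g' \<otimes>\<^bsub>G\<^esub> k) \<otimes>\<^bsub>H\<^esub> p (g' \<otimes>\<^bsub>G\<^esub> k \<otimes>\<^bsub>G\<^esub> l)"
      using \<delta>[OF g] by blast
    have "?F w (g \<otimes>\<^bsub>G\<^esub> k) = inv\<^bsub>H\<^esub> p (g' \<otimes>\<^bsub>G\<^esub> k) \<otimes>\<^bsub>H\<^esub> p (g' \<otimes>\<^bsub>G\<^esub> k \<otimes>\<^bsub>G\<^esub> word_prod G w)"
      if "set w \<subseteq> S" "k \<in> G.word_ball m" "m + length w \<le> M" for w k m
      using that
    proof (induction w arbitrary: k m)
      case Nil
      then have "k \<in> carrier G" using G.word_ball_closed by blast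
      then show ?case using g' p by simp
    next
      case (Cons s w)
      have k: "k \<in> carrier G" "k \<in> G.word_ball M"
        using Cons.prems G.word_ball_closed G.word_ball_mono[of m M] by auto
      have s: "s \<in> carrier G" "s \<in> G.word_ball M"
        using Cons.prems G.S_closed S_ball G.word_ball_mono[OF M(2)] by auto
      have w: "word_prod G w \<in> carrier G" using Cons.prems G.word_closed by simp
      have "k \<otimes>\<^bsub>G\<^esub> s \<in> G.word_ball (m + 1)"
        using Cons.prems S_ball by (intro G.word_ball_mult) auto
      then have "?F w (g \<otimes>\<^bsub>G\<^esub> (k \<otimes>\<^bsub>G\<^esub> s)) =
          inv\<^bsub>H\<^esub> p (g' \<otimes>\<^bsub>G\<^esub> (k \<otimes>\<^bsub>G\<^esub> s)) \<otimes>\<^bsub>H\<^esub> p (g' \<otimes>\<^bsub>G\<^esub> (k \<otimes>\<^bsub>G\<^esub> s) \<otimes>\<^bsub>G\<^esub> word_prod G w)"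
        using Cons.prems by (intro Cons.IH[of _ "m + 1"]) auto
      moreover have "\<delta> (g \<otimes>\<^bsub>G\<^esub> k) s = inv\<^bsub>H\<^esub> p (g' \<otimes>\<^bsub>G\<^esub> k) \<otimes>\<^bsub>H\<^esub> p (g' \<otimes>\<^bsub>G\<^esub> (k \<otimes>\<^bsub>G\<^esub> s))"
        using \<delta>'[OF k(2) s(2)] k s g' by (simp add: G.m_assoc)
      ultimately show ?case
        using k s w g g' p by (simp add: G.m_assoc H.ldiff_trans)
    qed
    with g' show ?thesis by blast
  qed
  have F_short: "\<exists>g'\<in>carrier G. \<forall>w. set w \<subseteq> S \<longrightarrow> length w \<le> M \<longrightarrow>
      ?F w g = inv\<^bsub>H\<^esub> p g' \<otimes>\<^bsub>H\<^esub> p (g' \<otimes>\<^bsub>G\<^esub> word_prod G w)" if "g \<in> carrier G" for g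
  proof -
    obtain g' where g': "g' \<in> carrier G" "\<And>w k m. set w \<subseteq> S \<Longrightarrow> k \<in> G.word_ball m \<Longrightarrow> m + length w \<le> M \<Longrightarrow>
      ?F w (g \<otimes>\<^bsub>G\<^esub> k) = inv\<^bsub>H\<^esub> p (g' \<otimes>\<^bsub>G\<^esub> k) \<otimes>\<^bsub>H\<^esub> p (g' \<otimes>\<^bsub>G\<^esub> k \<otimes>\<^bsub>G\<^esub> word_prod G w)"
      using local[OF \<open>g \<in> carrier G\<close>] by blast
    show ?thesis using g'(1) g'(2)[of _ "\<one>\<^bsub>G\<^esub>" 0] that G.one_word_ball by (intro bexI[of _ g']) auto
  qed
  have \<delta>_cl: "\<delta> g s \<in> carrier H" if gs: "g \<in> carrier G" "s \<in> S" for g s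
  proof -
    obtain g' where g': "g' \<in> carrier G" "\<And>k l. k \<in> G.word_ball M \<Longrightarrow> l \<in> G.word_ball M \<Longrightarrow>
      \<delta> (g \<otimes>\<^bsub>G\<^esub> k) l = inv\<^bsub>H\<^esub> p (g' \<otimes>\<^bsub>G\<^esub> k) \<otimes>\<^bsub>H\<^esub> p (g' \<otimes>\<^bsub>G\<^esub> k \<otimes>\<^bsub>G\<^esub> l)"
      using \<delta>[OF gs(1)] by blast
    have "s \<in> G.word_ball M" "s \<in> carrier G" using that S_ball G.word_ball_mono[OF M(2)] G.S_closed by auto
    then show ?thesis using g'(2)[OF G.one_word_ball, of s] g'(1) that p by simp
  qed
  have F_cl: "?F w g \<in> carrier H" if "set w \<subseteq> S" "g \<in> carrier G" for w g
    using that
  proof (induction w arbitrary: g)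
    case (Cons s w)
    then have "s \<in> carrier G" using G.S_closed by auto
    then show ?case using Cons.IH[of "g \<otimes>\<^bsub>G\<^esub> s"] Cons.prems \<delta>_cl by simp
  qed simp
  have F_append: "?F (u @ v) g = ?F u g \<otimes>\<^bsub>H\<^esub> ?F v (g \<otimes>\<^bsub>G\<^esub> word_prod G u)"
    if "set u \<subseteq> S" "set v \<subseteq> S" "g \<in> carrier G" for u v g
    using that
  proof (induction u arbitrary: g)
    case (Cons s u)
    then have s: "s \<in> carrier G" "word_prod G u \<in> carrier G" using G.S_closed G.word_closed by auto
    then show ?case using Cons.IH[of "g \<otimes>\<^bsub>G\<^esub> s"] Cons.prems \<delta>_cl F_cl by (simp add: G.m_assoc H.m_assoc)
  qed (simp add: F_cl)
  have F_eq: "?F w g = ?F w' g" if "word_eq G S N w w'" "g \<in> carrier G" for w w' g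
    using that(1) unfolding word_eq_def
  proof (induction rule: rtranclp_induct)
    case (step y z)
    from step.hyps(2) have "?F y g = ?F z g"
    proof cases
      case (word_stepI u v r r')
      have a: "g \<otimes>\<^bsub>G\<^esub> word_prod G u \<in> carrier G" using that(2) word_stepI G.word_closed by simp
      obtain x where x: "\<And>w. set w \<subseteq> S \<Longrightarrow> length w \<le> M \<Longrightarrow>
          ?F w (g \<otimes>\<^bsub>G\<^esub> word_prod G u) = inv\<^bsub>H\<^esub> p x \<otimes>\<^bsub>H\<^esub> p (x \<otimes>\<^bsub>G\<^esub> word_prod G w)"
        using F_short[OF a] by blast
      have "?F r (g \<otimes>\<^bsub>G\<^esub> word_prod G u) = ?F r' (g \<otimes>\<^bsub>G\<^esub> word_prod G u)"
        using x[of r] x[of r'] word_stepI(5-9) M by simp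
      then show ?thesis using word_stepI that(2) a by (simp add: F_append)
    qed
    with step.IH show ?case by simp
  qed simp
  have F_periodic: "?F w (a \<otimes>\<^bsub>G\<^esub> g) = ?F w g" if "a \<in> G\<^sub>0" "set w \<subseteq> S" "g \<in> carrier G" for a w g
    using that(2,3)
  proof (induction w arbitrary: g)
    case (Cons s w)
    then have s: "s \<in> carrier G" "a \<in> carrier G" using G.S_closed that G\<^sub>0 by auto
    then show ?case
      using Cons.IH[of "g \<otimes>\<^bsub>G\<^esub> s"] Cons.prems G\<^sub>0(2)[OF that(1)] by (simp add: G.m_assoc)
  qed simp
  define f where "f x = ?F (geodesic_word G S x) \<one>\<^bsub>G\<^esub>" for x
  have f_word: "f (word_prod G w) = ?F w \<one>\<^bsub>G\<^esub>" if "set w \<subseteq> S" for w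
    unfolding f_def
    using that N G.geodesic_word[OF G.word_closed[OF that]] unfolding boundedly_presented_def
    by (intro F_eq) auto
  have f_append: "f (g \<otimes>\<^bsub>G\<^esub> word_prod G v) = f g \<otimes>\<^bsub>H\<^esub> ?F v g"
    if gv: "g \<in> carrier G" "set v \<subseteq> S" for g v
  proof -
    obtain u where u: "set u \<subseteq> S" "word_prod G u = g" using G.ex_word[OF gv(1)] by blast
    then have "f (g \<otimes>\<^bsub>G\<^esub> word_prod G v) = ?F (u @ v) \<one>\<^bsub>G\<^esub>"
      using f_word[of "u @ v"] that by (simp add: G.word_append)
    also have "\<dots> = f g \<otimes>\<^bsub>H\<^esub> ?F v g" using u that f_word[of u] by (simp add: F_append)
    finally show ?thesis .
  qed
  have f_cl: "f g \<in> carrier H" if "g \<in> carrier G" for g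
    unfolding f_def using that by (intro F_cl G.geodesic_word) auto
  show ?thesis
  proof (rule that)
    show "f \<in> carrier G \<rightarrow> carrier H" using f_cl by simp
    show "f (a \<otimes>\<^bsub>G\<^esub> g) = f a \<otimes>\<^bsub>H\<^esub> f g" if ag: "a \<in> G\<^sub>0" "g \<in> carrier G" for a g
    proof -
      obtain v where v: "set v \<subseteq> S" "word_prod G v = g" using G.ex_word[OF ag(2)] by blast
      have a: "a \<in> carrier G" using that G\<^sub>0 by auto
      have "f (a \<otimes>\<^bsub>G\<^esub> g) = f a \<otimes>\<^bsub>H\<^esub> ?F v a" using f_append[of a v] a v by simp
      \<comment> \<open>Periodicity moves the start of the path from \<open>a\<close> back to the
        identity: this is where invariance becomes multiplicativity.\<close>
      also have "?F v a = ?F v \<one>\<^bsub>G\<^esub>" using F_periodic[OF that(1) v(1), of "\<one>\<^bsub>G\<^esub>"] a by simp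
      also have "\<dots> = f g" using f_word v by metis
      finally show ?thesis .
    qed
    show "locally_like G H (G.word_ball M) f p"
      unfolding locally_like_def
    proof
      fix g assume g: "g \<in> carrier G"
      obtain g' where g': "g' \<in> carrier G" "\<And>w. set w \<subseteq> S \<Longrightarrow> length w \<le> M \<Longrightarrow>
        ?F w g = inv\<^bsub>H\<^esub> p g' \<otimes>\<^bsub>H\<^esub> p (g' \<otimes>\<^bsub>G\<^esub> word_prod G w)" using F_short[OF g] by blast
      have "inv\<^bsub>H\<^esub> f g \<otimes>\<^bsub>H\<^esub> f (g \<otimes>\<^bsub>G\<^esub> k) = inv\<^bsub>H\<^esub> p g' \<otimes>\<^bsub>H\<^esub> p (g' \<otimes>\<^bsub>G\<^esub> k)" if k: "k \<in> G.word_ball M" for k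
      proof -
        obtain w where w: "set w \<subseteq> S" "length w \<le> M" "k = word_prod G w"
          using k unfolding G.word_ball_def by blast
        then show ?thesis using f_append[OF g w(1)] g'(2)[OF w(1,2)] f_cl[OF g] F_cl[OF w(1) g]
          by (simp add: H.ldiff_mult)
      qed
      with g' show "\<exists>g'\<in>carrier G. \<forall>k\<in>G.word_ball M.
          inv\<^bsub>H\<^esub> f g \<otimes>\<^bsub>H\<^esub> f (g \<otimes>\<^bsub>G\<^esub> k) = inv\<^bsub>H\<^esub> p g' \<otimes>\<^bsub>H\<^esub> p (g' \<otimes>\<^bsub>G\<^esub> k)" by blast
    qed
  qed
qed

section \<open>Maps that locally look like a coarse equivalence\<close>

text \<open>A state \<open>(h, g)\<close> with \<open>h\<inverse> f g \<in> D\<close> is a point of the fibre of \<open>f\<close> near \<open>h\<close>, and \<open>run\<close> lifts paths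
  in \<open>H\<close> to states. Fibres split into clusters of bounded diameter; since \<open>H\<close> has bounded
  presentation, the monodromy action on clusters is trivial, so that each fibre is one cluster.\<close>

locale local_lifting = G: word_group G S + H: word_group H T
  for G :: "('a, 'm) monoid_scheme" and S and H :: "('b, 'n) monoid_scheme" and T +
  fixes f :: "'a \<Rightarrow> 'b" and D :: "'b set" and K\<^sub>0 :: "'a set" and M m N :: nat
  assumes f_closed: "g \<in> carrier G \<Longrightarrow> f g \<in> carrier H"
    and one_D: "\<one>\<^bsub>H\<^esub> \<in> D"
    and gap: "h \<in> carrier H \<Longrightarrow> g \<in> carrier G \<Longrightarrow> g' \<in> carrier G \<Longrightarrow>
      inv\<^bsub>H\<^esub> h \<otimes>\<^bsub>H\<^esub> f g \<in> D \<Longrightarrow> inv\<^bsub>H\<^esub> h \<otimes>\<^bsub>H\<^esub> f g' \<in> D \<Longrightarrow>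
      inv\<^bsub>G\<^esub> g \<otimes>\<^bsub>G\<^esub> g' \<in> G.word_ball M \<Longrightarrow> inv\<^bsub>G\<^esub> g \<otimes>\<^bsub>G\<^esub> g' \<in> K\<^sub>0"
    and lift: "h \<in> carrier H \<Longrightarrow> g \<in> carrier G \<Longrightarrow> inv\<^bsub>H\<^esub> h \<otimes>\<^bsub>H\<^esub> f g \<in> D \<Longrightarrow> t \<in> T \<Longrightarrow>
      \<exists>g'\<in>carrier G. inv\<^bsub>H\<^esub> (h \<otimes>\<^bsub>H\<^esub> t) \<otimes>\<^bsub>H\<^esub> f g' \<in> D \<and> inv\<^bsub>G\<^esub> g \<otimes>\<^bsub>G\<^esub> g' \<in> G.word_ball m"
    and step_N: "g \<in> carrier G \<Longrightarrow> s \<in> S \<Longrightarrow> inv\<^bsub>H\<^esub> f g \<otimes>\<^bsub>H\<^esub> f (g \<otimes>\<^bsub>G\<^esub> s) \<in> H.word_ball N"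
    and presented: "boundedly_presented H T N"
    and K\<^sub>0_closed: "K\<^sub>0 \<subseteq> carrier G"
    and inv_K\<^sub>0: "m_inv G ` K\<^sub>0 \<subseteq> G.word_ball M"
    and mult_K\<^sub>0: "K\<^sub>0 <#>\<^bsub>G\<^esub> K\<^sub>0 \<subseteq> G.word_ball M"
    and conj_K\<^sub>0: "m_inv G ` G.word_ball m <#>\<^bsub>G\<^esub> K\<^sub>0 <#>\<^bsub>G\<^esub> G.word_ball m \<subseteq> G.word_ball M"
    and run_M: "m_inv G ` G.word_ball (m * N) <#>\<^bsub>G\<^esub> (S \<union> G.word_ball (m * N)) \<subseteq> G.word_ball M"
begin

section \<open>Clusters in the fibres\<close>

definition state :: "'b \<Rightarrow> 'a \<Rightarrow> bool" where
  "state h g \<longleftrightarrow> h \<in> carrier H \<and> g \<in> carrier G \<and> inv\<^bsub>H\<^esub> h \<otimes>\<^bsub>H\<^esub> f g \<in> D"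

definition same_cluster :: "'b \<Rightarrow> 'a \<Rightarrow> 'a \<Rightarrow> bool" where
  "same_cluster h g g' \<longleftrightarrow> state h g \<and> state h g' \<and> inv\<^bsub>G\<^esub> g \<otimes>\<^bsub>G\<^esub> g' \<in> K\<^sub>0"

text \<open>By \<open>gap\<close>, distances between the scale of \<open>K\<^sub>0\<close> and
  \<open>M\<close> do not occur over one \<open>h\<close>. Hence being \<open>M\<close>-close is as
  good as differing by \<open>K\<^sub>0\<close>, and closeness becomes transitive without
  loss.\<close>

lemma same_clusterI:
  "state h g \<Longrightarrow> state h g' \<Longrightarrow> inv\<^bsub>G\<^esub> g \<otimes>\<^bsub>G\<^esub> g' \<in> G.word_ball M \<Longrightarrow> same_cluster h g g'"
  unfolding same_cluster_def state_def using gap by blast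

lemma same_cluster_refl: "state h g \<Longrightarrow> same_cluster h g g"
  by (rule same_clusterI) (auto simp: state_def G.one_word_ball)

lemma same_cluster_sym:
  assumes "same_cluster h g g'"
  shows "same_cluster h g' g"
proof (rule same_clusterI)
  have "inv\<^bsub>G\<^esub> (inv\<^bsub>G\<^esub> g \<otimes>\<^bsub>G\<^esub> g') \<in> G.word_ball M" using inv_K\<^sub>0 assms by (auto simp: same_cluster_def)
  then show "inv\<^bsub>G\<^esub> g' \<otimes>\<^bsub>G\<^esub> g \<in> G.word_ball M"
    using assms by (simp add: same_cluster_def state_def G.ldiff_inv)
qed (use assms in \<open>auto simp: same_cluster_def\<close>)

lemma same_cluster_trans:
  assumes "same_cluster h a b" "same_cluster h b c"
  shows "same_cluster h a c"
proof (rule same_clusterI)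
  have "(inv\<^bsub>G\<^esub> a \<otimes>\<^bsub>G\<^esub> b) \<otimes>\<^bsub>G\<^esub> (inv\<^bsub>G\<^esub> b \<otimes>\<^bsub>G\<^esub> c) \<in> G.word_ball M"
    using assms by (intro subsetD[OF mult_K\<^sub>0] set_multI) (auto simp: same_cluster_def)
  then show "inv\<^bsub>G\<^esub> a \<otimes>\<^bsub>G\<^esub> c \<in> G.word_ball M"
    using assms by (simp add: same_cluster_def state_def G.ldiff_trans)
qed (use assms in \<open>auto simp: same_cluster_def\<close>)

section \<open>Path lifting and its homotopy invariance\<close>

definition next_state :: "'b \<Rightarrow> 'b \<Rightarrow> 'a \<Rightarrow> 'a" where
  "next_state t h g = (SOME g'. state (h \<otimes>\<^bsub>H\<^esub> t) g' \<and> inv\<^bsub>G\<^esub> g \<otimes>\<^bsub>G\<^esub> g' \<in> G.word_ball m)"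

lemma next_state:
  assumes "state h g" "t \<in> T"
  shows "state (h \<otimes>\<^bsub>H\<^esub> t) (next_state t h g)"
    "inv\<^bsub>G\<^esub> g \<otimes>\<^bsub>G\<^esub> next_state t h g \<in> G.word_ball m"
proof -
  have "t \<in> carrier H" using assms H.S_closed by auto
  then have "\<exists>g'. state (h \<otimes>\<^bsub>H\<^esub> t) g' \<and> inv\<^bsub>G\<^esub> g \<otimes>\<^bsub>G\<^esub> g' \<in> G.word_ball m"
    using lift[of h g t] assms unfolding state_def by auto
  from someI_ex[OF this] show "state (h \<otimes>\<^bsub>H\<^esub> t) (next_state t h g)"
    "inv\<^bsub>G\<^esub> g \<otimes>\<^bsub>G\<^esub> next_state t h g \<in> G.word_ball m"
    unfolding next_state_def by auto
qed

primrec run :: "'b list \<Rightarrow> 'b \<Rightarrow> 'a \<Rightarrow> 'a" where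
  "run [] h g = g"
| "run (t # w) h g = run w (h \<otimes>\<^bsub>H\<^esub> t) (next_state t h g)"

lemma run_state:
  assumes "state h g" "set w \<subseteq> T"
  shows "state (h \<otimes>\<^bsub>H\<^esub> word_prod H w) (run w h g)"
    and "inv\<^bsub>G\<^esub> g \<otimes>\<^bsub>G\<^esub> run w h g \<in> G.word_ball (m * length w)"
proof -
  have "state (h \<otimes>\<^bsub>H\<^esub> word_prod H w) (run w h g) \<and>
    inv\<^bsub>G\<^esub> g \<otimes>\<^bsub>G\<^esub> run w h g \<in> G.word_ball (m * length w)"
    using assms
  proof (induction w arbitrary: h g)
    case Nil
    then show ?case by (simp add: state_def G.one_word_ball)
  next
    case (Cons t w)
    let ?g = "next_state t h g" and ?h = "h \<otimes>\<^bsub>H\<^esub> t"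
    have t: "t \<in> T" "t \<in> carrier H" "h \<in> carrier H" "word_prod H w \<in> carrier H"
      using Cons.prems H.S_closed H.word_closed by (auto simp: state_def)
    note n = next_state[OF Cons.prems(1) t(1)]
    have IH: "state (?h \<otimes>\<^bsub>H\<^esub> word_prod H w) (run w ?h ?g)"
      "inv\<^bsub>G\<^esub> ?g \<otimes>\<^bsub>G\<^esub> run w ?h ?g \<in> G.word_ball (m * length w)"
      using Cons.IH[OF n(1)] Cons.prems by auto
    have "(inv\<^bsub>G\<^esub> g \<otimes>\<^bsub>G\<^esub> ?g) \<otimes>\<^bsub>G\<^esub> (inv\<^bsub>G\<^esub> ?g \<otimes>\<^bsub>G\<^esub> run w ?h ?g) \<in> G.word_ball (m + m * length w)"
      using n IH by (intro G.word_ball_mult)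
    then show ?case
      using IH(1) t n(1) Cons.prems(1) by (simp add: state_def H.m_assoc G.ldiff_trans)
  qed
  then show "state (h \<otimes>\<^bsub>H\<^esub> word_prod H w) (run w h g)"
    "inv\<^bsub>G\<^esub> g \<otimes>\<^bsub>G\<^esub> run w h g \<in> G.word_ball (m * length w)" by auto
qed

lemma run_append:
  "h \<in> carrier H \<Longrightarrow> set u \<subseteq> T \<Longrightarrow> set v \<subseteq> T \<Longrightarrow>
    run (u @ v) h g = run v (h \<otimes>\<^bsub>H\<^esub> word_prod H u) (run u h g)"
proof (induction u arbitrary: h g)
  case (Cons t u)
  then have "t \<in> carrier H" "word_prod H u \<in> carrier H" using H.S_closed H.word_closed by auto
  then show ?case using Cons by (simp add: H.m_assoc)
qed simp

text \<open>Each lifted step moves by at most \<open>m\<close>, so \<open>conj_K\<^sub>0\<close>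
  puts the new endpoints within \<open>M\<close> of each other, and \<open>gap\<close> returns their
  difference to \<open>K\<^sub>0\<close>. No drift accumulates along the word.\<close>

lemma run_same_cluster:
  "same_cluster h g g' \<Longrightarrow> set w \<subseteq> T \<Longrightarrow>
    same_cluster (h \<otimes>\<^bsub>H\<^esub> word_prod H w) (run w h g) (run w h g')"
proof (induction w arbitrary: h g g')
  case Nil
  then show ?case by (simp add: same_cluster_def state_def)
next
  case (Cons t w)
  have s: "state h g" "state h g'" using Cons.prems by (auto simp: same_cluster_def)
  have t: "t \<in> T" "t \<in> carrier H" "word_prod H w \<in> carrier H"
    using Cons.prems H.S_closed H.word_closed by auto
  note n = next_state[OF s(1) t(1)] and n' = next_state[OF s(2) t(1)]
  let ?a = "next_state t h g" and ?a' = "next_state t h g'"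
  have "same_cluster (h \<otimes>\<^bsub>H\<^esub> t) ?a ?a'"
  proof (rule same_clusterI[OF n(1) n'(1)])
    have "inv\<^bsub>G\<^esub> (inv\<^bsub>G\<^esub> g \<otimes>\<^bsub>G\<^esub> ?a) \<otimes>\<^bsub>G\<^esub> (inv\<^bsub>G\<^esub> g \<otimes>\<^bsub>G\<^esub> g') \<otimes>\<^bsub>G\<^esub> (inv\<^bsub>G\<^esub> g' \<otimes>\<^bsub>G\<^esub> ?a') \<in> G.word_ball M"
      using n n' Cons.prems(1)
      by (intro subsetD[OF conj_K\<^sub>0] set_multI imageI) (auto simp: same_cluster_def)
    then show "inv\<^bsub>G\<^esub> ?a \<otimes>\<^bsub>G\<^esub> ?a' \<in> G.word_ball M"
      using s n n' by (simp add: state_def G.ldiff_inv G.ldiff_trans)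
  qed
  from Cons.IH[OF this] show ?case using Cons.prems s t by (simp add: state_def H.m_assoc)
qed

text \<open>Lifts of two words of length at most \<open>N\<close> from one state end within the
  bound of \<open>run_M\<close>, hence in one cluster; the remaining letters preserve
  clusters.\<close>

lemma run_word_eq:
  assumes "word_eq H T N w w'" "state h g" "set w \<subseteq> T"
  shows "set w' \<subseteq> T \<and> same_cluster (h \<otimes>\<^bsub>H\<^esub> word_prod H w) (run w h g) (run w' h g)"
  using assms(1) unfolding word_eq_def
proof (induction rule: rtranclp_induct)
  case base
  show ?case using run_state[OF assms(2,3)] same_cluster_refl assms(3) by blast
next
  case (step y z)
  have "word_eq H T N w y" using step.hyps(1) by (simp add: word_eq_def)
  then have wy: "word_prod H w = word_prod H y" by (rule H.word_eq_prod)
  have "set z \<subseteq> T \<and> same_cluster (h \<otimes>\<^bsub>H\<^esub> word_prod H y) (run y h g) (run z h g)"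
    using step.hyps(2)
  proof cases
    case (word_stepI u v r r')
    let ?h = "h \<otimes>\<^bsub>H\<^esub> word_prod H u" and ?g = "run u h g"
    have h: "h \<in> carrier H" using assms(2) by (simp add: state_def)
    have cl: "word_prod H u \<in> carrier H" "word_prod H v \<in> carrier H" "word_prod H r \<in> carrier H"
      using word_stepI H.word_closed by auto
    have s: "state ?h ?g" using run_state[OF assms(2)] word_stepI by simp
    have ball: "inv\<^bsub>G\<^esub> ?g \<otimes>\<^bsub>G\<^esub> run x ?h ?g \<in> G.word_ball (m * N)" if "set x \<subseteq> T" "length x \<le> N" for x
      using run_state(2)[OF s that(1)] G.word_ball_mono[OF mult_le_mono2[OF that(2), of m]] by blast
    have st: "state (?h \<otimes>\<^bsub>H\<^esub> word_prod H r) (run r ?h ?g)" "state (?h \<otimes>\<^bsub>H\<^esub> word_prod H r) (run r' ?h ?g)"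
      using run_state(1)[OF s, of r] run_state(1)[OF s, of r'] word_stepI by auto
    have "same_cluster (?h \<otimes>\<^bsub>H\<^esub> word_prod H r) (run r ?h ?g) (run r' ?h ?g)"
    proof (rule same_clusterI[OF st])
      have "inv\<^bsub>G\<^esub> (inv\<^bsub>G\<^esub> ?g \<otimes>\<^bsub>G\<^esub> run r ?h ?g) \<otimes>\<^bsub>G\<^esub> (inv\<^bsub>G\<^esub> ?g \<otimes>\<^bsub>G\<^esub> run r' ?h ?g) \<in> G.word_ball M"
        using word_stepI by (intro subsetD[OF run_M] set_multI imageI UnI2 ball)
      then show "inv\<^bsub>G\<^esub> run r ?h ?g \<otimes>\<^bsub>G\<^esub> run r' ?h ?g \<in> G.word_ball M"
        using s st by (simp add: state_def G.ldiff_inv G.ldiff_trans)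
    qed
    from run_same_cluster[OF this, of v]
    have "same_cluster (h \<otimes>\<^bsub>H\<^esub> word_prod H y) (run y h g) (run z h g)"
      using word_stepI h cl by (simp add: run_append H.word_append H.m_assoc)
    then show ?thesis using word_stepI by auto
  qed
  with step.IH wy show ?case by (metis same_cluster_trans)
qed

lemma state_self: "g \<in> carrier G \<Longrightarrow> state (f g) g"
  by (simp add: state_def f_closed one_D)

text \<open>A path in \<open>G\<close> is, up to clusters, the lift of its own image in
  \<open>H\<close>, so the arbitrary choices in \<open>next_state\<close> can be compared with
  actual points of \<open>G\<close>.\<close>

lemma run_along:
  assumes "set u \<subseteq> S" "g \<in> carrier G"
  shows "\<exists>w. set w \<subseteq> T \<and> f g \<otimes>\<^bsub>H\<^esub> word_prod H w = f (g \<otimes>\<^bsub>G\<^esub> word_prod G u) \<and>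
    same_cluster (f (g \<otimes>\<^bsub>G\<^esub> word_prod G u)) (run w (f g) g) (g \<otimes>\<^bsub>G\<^esub> word_prod G u)"
  using assms(1)
proof (induction u rule: rev_induct)
  case Nil
  show ?case using assms(2) f_closed state_self by (intro exI[of _ "[]"]) (auto simp: same_cluster_refl)
next
  case (snoc s u)
  let ?x = "g \<otimes>\<^bsub>G\<^esub> word_prod G u"
  have s: "s \<in> S" "s \<in> carrier G" using snoc.prems G.S_closed by auto
  have x: "?x \<in> carrier G" using snoc.prems assms(2) G.word_closed by simp
  have xs: "g \<otimes>\<^bsub>G\<^esub> word_prod G (u @ [s]) = ?x \<otimes>\<^bsub>G\<^esub> s"
    using snoc.prems s assms(2) G.word_closed by (simp add: G.word_append G.m_assoc)
  obtain w where w: "set w \<subseteq> T" "f g \<otimes>\<^bsub>H\<^esub> word_prod H w = f ?x" "same_cluster (f ?x) (run w (f g) g) ?x"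
    using snoc by auto
  define v where "v = geodesic_word H T (inv\<^bsub>H\<^esub> f ?x \<otimes>\<^bsub>H\<^esub> f (?x \<otimes>\<^bsub>G\<^esub> s))"
  have v: "set v \<subseteq> T" "word_prod H v = inv\<^bsub>H\<^esub> f ?x \<otimes>\<^bsub>H\<^esub> f (?x \<otimes>\<^bsub>G\<^esub> s)" "length v \<le> N"
    unfolding v_def using x s f_closed H.geodesic_word H.length_geodesic_word step_N by auto
  have fv: "f ?x \<otimes>\<^bsub>H\<^esub> word_prod H v = f (?x \<otimes>\<^bsub>G\<^esub> s)" using v x s f_closed by (simp add: H.mult_ldiff)
  have "same_cluster (f (?x \<otimes>\<^bsub>G\<^esub> s)) (run v (f ?x) (run w (f g) g)) (run v (f ?x) ?x)"
    using run_same_cluster[OF w(3) v(1)] fv by simp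
  moreover have "same_cluster (f (?x \<otimes>\<^bsub>G\<^esub> s)) (run v (f ?x) ?x) (?x \<otimes>\<^bsub>G\<^esub> s)"
  proof (rule same_clusterI)
    show st: "state (f (?x \<otimes>\<^bsub>G\<^esub> s)) (run v (f ?x) ?x)"
      using run_state(1)[OF state_self[OF x] v(1)] fv by simp
    show "state (f (?x \<otimes>\<^bsub>G\<^esub> s)) (?x \<otimes>\<^bsub>G\<^esub> s)" using x s by (intro state_self) auto
    have "inv\<^bsub>G\<^esub> ?x \<otimes>\<^bsub>G\<^esub> run v (f ?x) ?x \<in> G.word_ball (m * N)"
      using run_state(2)[OF state_self[OF x] v(1)] G.word_ball_mono[OF mult_le_mono2[OF v(3), of m]] by blast
    \<comment> \<open>Both endpoints are measured from \<open>?x\<close>: the lift of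
      \<open>v\<close> moves at most \<open>m * N\<close>, the path in \<open>G\<close> takes the
      single step \<open>s\<close>. This explains \<open>S\<close> in \<open>run_M\<close>.\<close>
    then have "inv\<^bsub>G\<^esub> (inv\<^bsub>G\<^esub> ?x \<otimes>\<^bsub>G\<^esub> run v (f ?x) ?x) \<otimes>\<^bsub>G\<^esub> s \<in> G.word_ball M"
      using s by (intro subsetD[OF run_M] set_multI imageI UnI1)
    then show "inv\<^bsub>G\<^esub> run v (f ?x) ?x \<otimes>\<^bsub>G\<^esub> (?x \<otimes>\<^bsub>G\<^esub> s) \<in> G.word_ball M"
      using x s st by (simp add: state_def G.ldiff_inv G.m_assoc)
  qed
  ultimately have "same_cluster (f (?x \<otimes>\<^bsub>G\<^esub> s)) (run (w @ v) (f g) g) (?x \<otimes>\<^bsub>G\<^esub> s)"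
    using w v f_closed assms(2) same_cluster_trans by (simp add: run_append)
  moreover have "f g \<otimes>\<^bsub>H\<^esub> word_prod H (w @ v) = (f g \<otimes>\<^bsub>H\<^esub> word_prod H w) \<otimes>\<^bsub>H\<^esub> word_prod H v"
    using w(1) v(1) f_closed[OF assms(2)] H.word_closed by (simp add: H.word_append H.m_assoc)
  then have "f g \<otimes>\<^bsub>H\<^esub> word_prod H (w @ v) = f (?x \<otimes>\<^bsub>G\<^esub> s)" using w(2) fv by simp
  ultimately show ?case using w(1) v(1) unfolding xs by (intro exI[of _ "w @ v"]) auto
qed

text \<open>A path from \<open>g\<close> to \<open>g'\<close> has a closed image in
  \<open>H\<close>. Its lift ends in the cluster of \<open>g'\<close> by \<open>run_along\<close>,
  and in that of \<open>g\<close> because the loop is homotopic to the empty word.\<close>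

lemma fibre_bounded:
  assumes "g \<in> carrier G" "g' \<in> carrier G" "f g = f g'"
  shows "inv\<^bsub>G\<^esub> g \<otimes>\<^bsub>G\<^esub> g' \<in> K\<^sub>0"
proof -
  obtain u where u: "set u \<subseteq> S" "word_prod G u = inv\<^bsub>G\<^esub> g \<otimes>\<^bsub>G\<^esub> g'"
    using G.ex_word[of "inv\<^bsub>G\<^esub> g \<otimes>\<^bsub>G\<^esub> g'"] assms by auto
  have gu: "g \<otimes>\<^bsub>G\<^esub> word_prod G u = g'" using u assms by (simp add: G.mult_ldiff)
  obtain w where w: "set w \<subseteq> T" "f g \<otimes>\<^bsub>H\<^esub> word_prod H w = f g"
      "same_cluster (f g) (run w (f g) g) g'"
    using run_along[OF u(1) assms(1)] assms(3) unfolding gu by auto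
  have "word_prod H w = word_prod H []"
    using w(2) f_closed[OF assms(1)] H.word_closed[OF w(1)] by simp
  then have "word_eq H T N w []" using presented w(1) unfolding boundedly_presented_def by simp
  from run_word_eq[OF this state_self[OF assms(1)] w(1)] w(2)
  have "same_cluster (f g) (run w (f g) g) g" by simp
  then have "same_cluster (f g) g g'" using w(3) same_cluster_sym same_cluster_trans by blast
  then show ?thesis by (simp add: same_cluster_def)
qed

text \<open>Any \<open>h\<close> is reached by lifting a path from the image of the identity; the
  final state witnesses density.\<close>

lemma image_dense:
  assumes "h \<in> carrier H"
  shows "\<exists>g\<in>carrier G. inv\<^bsub>H\<^esub> h \<otimes>\<^bsub>H\<^esub> f g \<in> D"
proof -
  let ?o = "\<one>\<^bsub>G\<^esub>"
  have o: "f ?o \<in> carrier H" by (simp add: f_closed)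
  obtain w where w: "set w \<subseteq> T" "word_prod H w = inv\<^bsub>H\<^esub> f ?o \<otimes>\<^bsub>H\<^esub> h"
    using H.ex_word[of "inv\<^bsub>H\<^esub> f ?o \<otimes>\<^bsub>H\<^esub> h"] o assms by auto
  then have "state h (run w (f ?o) ?o)"
    using run_state(1)[OF state_self[of ?o] w(1)] o assms by (simp add: H.mult_ldiff)
  then show ?thesis by (auto simp: state_def)
qed

end

text \<open>\<open>D\<close> comes from density of \<open>p\<close>, \<open>K\<close> and
  \<open>m\<close> from its properness. \<open>M\<^sub>0\<close> is a radius large enough for the
  lifting argument to work for any \<open>f\<close> resembling \<open>p\<close> at that
  scale.\<close>

lemma locally_like_geometry:
  assumes G: "word_group G S" and H: "word_group H T" and N\<^sub>0: "boundedly_presented H T N\<^sub>0"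
    and p: "coarse_equivalence G H p"
  obtains D K M\<^sub>0 where "finite D" "D \<subseteq> carrier H" "finite K"
    "\<And>f M g g'. M\<^sub>0 \<le> M \<Longrightarrow> f \<in> carrier G \<rightarrow> carrier H \<Longrightarrow>
      locally_like G H (word_group.word_ball G S M) f p \<Longrightarrow>
      g \<in> carrier G \<Longrightarrow> g' \<in> carrier G \<Longrightarrow> f g = f g' \<Longrightarrow> inv\<^bsub>G\<^esub> g \<otimes>\<^bsub>G\<^esub> g' \<in> K"
    "\<And>f M h. M\<^sub>0 \<le> M \<Longrightarrow> f \<in> carrier G \<rightarrow> carrier H \<Longrightarrow>
      locally_like G H (word_group.word_ball G S M) f p \<Longrightarrow>
      h \<in> carrier H \<Longrightarrow> \<exists>g\<in>carrier G. inv\<^bsub>H\<^esub> h \<otimes>\<^bsub>H\<^esub> f g \<in> D"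
proof -
  interpret G: word_group G S by fact
  interpret H: word_group H T by fact
  note p_cl = coarse_equivalence_closed[OF p]
  obtain D\<^sub>0 where D\<^sub>0: "finite D\<^sub>0" "\<And>h. h \<in> carrier H \<Longrightarrow> \<exists>g\<in>carrier G. inv\<^bsub>H\<^esub> h \<otimes>\<^bsub>H\<^esub> p g \<in> D\<^sub>0"
    using coarse_equivalence_dense[OF p] by blast
  \<comment> \<open>The identity is added so that each \<open>g\<close> is a state over
    \<open>f g\<close>.\<close>
  define D where "D = insert \<one>\<^bsub>H\<^esub> (D\<^sub>0 \<inter> carrier H)"
  have D: "finite D" "D \<subseteq> carrier H" "\<one>\<^bsub>H\<^esub> \<in> D" using D\<^sub>0(1) by (auto simp: D_def)
  have dense: "\<exists>g\<in>carrier G. inv\<^bsub>H\<^esub> h \<otimes>\<^bsub>H\<^esub> p g \<in> D" if "h \<in> carrier H" for h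
    using D\<^sub>0(2)[OF that] that p_cl by (auto simp: D_def)
  have fin: "finite (m_inv H ` D <#>\<^bsub>H\<^esub> T <#>\<^bsub>H\<^esub> D)" "finite (m_inv H ` D <#>\<^bsub>H\<^esub> D)"
    using D H.fin_S by (auto intro: finite_set_mult)
  obtain K\<^sub>1 where K\<^sub>1: "finite K\<^sub>1" "\<And>x y. x \<in> carrier G \<Longrightarrow> y \<in> carrier G \<Longrightarrow>
      inv\<^bsub>H\<^esub> p x \<otimes>\<^bsub>H\<^esub> p y \<in> m_inv H ` D <#>\<^bsub>H\<^esub> T <#>\<^bsub>H\<^esub> D \<Longrightarrow> inv\<^bsub>G\<^esub> x \<otimes>\<^bsub>G\<^esub> y \<in> K\<^sub>1"
    using coarse_equivalence_proper[OF p fin(1)] by blast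
  obtain K' where K': "finite K'" "\<And>x y. x \<in> carrier G \<Longrightarrow> y \<in> carrier G \<Longrightarrow>
      inv\<^bsub>H\<^esub> p x \<otimes>\<^bsub>H\<^esub> p y \<in> m_inv H ` D <#>\<^bsub>H\<^esub> D \<Longrightarrow> inv\<^bsub>G\<^esub> x \<otimes>\<^bsub>G\<^esub> y \<in> K'"
    using coarse_equivalence_proper[OF p fin(2)] by blast
  define K where "K = K' \<inter> carrier G"
  have K: "finite K" "K \<subseteq> carrier G" using K' by (auto simp: K_def)
  obtain m where m: "K\<^sub>1 \<inter> carrier G \<subseteq> G.word_ball m"
    using G.finite_subset_word_ball[of "K\<^sub>1 \<inter> carrier G"] K\<^sub>1(1) by auto
  obtain c where c: "\<And>g s. g \<in> carrier G \<Longrightarrow> s \<in> S \<Longrightarrow>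
      inv\<^bsub>H\<^esub> p g \<otimes>\<^bsub>H\<^esub> p (g \<otimes>\<^bsub>G\<^esub> s) \<in> H.word_ball c"
    using coarse_equivalence_step_bound[OF G H p G.fin_S G.S_closed] by blast
  \<comment> \<open>\<open>N\<close> has to serve both for the relations of \<open>H\<close> and for
    the displacement of \<open>f\<close> along a generator.\<close>
  define N where "N = max N\<^sub>0 c"
  have bp: "boundedly_presented H T N" using boundedly_presented_mono[OF N\<^sub>0, of N] by (simp add: N_def)
  \<comment> \<open>The sets that must fit in the \<open>M\<close>-ball: for symmetry and
    transitivity of clusters, for their invariance under a lifted step, for comparing two lifts of a
    short word or a lift with a generator, and for copying from \<open>p\<close> along a generator
    or a displacement by \<open>m\<close>.\<close>
  let ?R = "m_inv G ` K \<union> (K <#>\<^bsub>G\<^esub> K) \<union> (m_inv G ` G.word_ball m <#>\<^bsub>G\<^esub> K <#>\<^bsub>G\<^esub> G.word_ball m) \<union>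
    (m_inv G ` G.word_ball (m * N) <#>\<^bsub>G\<^esub> (S \<union> G.word_ball (m * N))) \<union> S \<union> G.word_ball m"
  have "finite ?R"
    using K G.fin_S G.word_ball_finite by (intro finite_UnI finite_set_mult finite_imageI)
  moreover have "?R \<subseteq> carrier G"
    using K G.S_closed G.word_ball_closed by (auto simp: set_mult_def dest!: subsetD[OF G.word_ball_closed])
  ultimately obtain M\<^sub>0 where M\<^sub>0: "?R \<subseteq> G.word_ball M\<^sub>0" by (rule G.finite_subset_word_ball)
  have lifting: "local_lifting G S H T f D K M m N"
    if M: "M\<^sub>0 \<le> M" and f: "f \<in> carrier G \<rightarrow> carrier H" and like: "locally_like G H (G.word_ball M) f p"
    for f M
  proof -
    have R: "?R \<subseteq> G.word_ball M" using M\<^sub>0 G.word_ball_mono[OF M] by blast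
    then have R': "m_inv G ` K \<subseteq> G.word_ball M" "K <#>\<^bsub>G\<^esub> K \<subseteq> G.word_ball M"
      "m_inv G ` G.word_ball m <#>\<^bsub>G\<^esub> K <#>\<^bsub>G\<^esub> G.word_ball m \<subseteq> G.word_ball M"
      "m_inv G ` G.word_ball (m * N) <#>\<^bsub>G\<^esub> (S \<union> G.word_ball (m * N)) \<subseteq> G.word_ball M"
      "S \<subseteq> G.word_ball M" "G.word_ball m \<subseteq> G.word_ball M"
      by (simp_all only: Un_subset_iff)
    have f_cl: "f g \<in> carrier H" if "g \<in> carrier G" for g using f that by auto
    have copy: "\<exists>g'\<in>carrier G. \<forall>k\<in>G.word_ball M.
        inv\<^bsub>H\<^esub> f g \<otimes>\<^bsub>H\<^esub> f (g \<otimes>\<^bsub>G\<^esub> k) = inv\<^bsub>H\<^esub> p g' \<otimes>\<^bsub>H\<^esub> p (g' \<otimes>\<^bsub>G\<^esub> k)" if "g \<in> carrier G" for g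
      using like that unfolding locally_like_def by blast
    show ?thesis
    proof (unfold_locales, goal_cases)
      case (1 g)
      then show ?case by (rule f_cl)
    next
      case 2
      show ?case by (rule D)
    next
      \<comment> \<open>Since \<open>g\<close> and \<open>g'\<close> are \<open>M\<close>-close,
        their difference under \<open>f\<close> also occurs under \<open>p\<close> with the same
        displacement, and properness of \<open>p\<close> bounds that displacement.\<close>
      case (3 h g g')
      let ?k = "inv\<^bsub>G\<^esub> g \<otimes>\<^bsub>G\<^esub> g'"
      obtain x where x: "x \<in> carrier G" "inv\<^bsub>H\<^esub> f g \<otimes>\<^bsub>H\<^esub> f (g \<otimes>\<^bsub>G\<^esub> ?k) = inv\<^bsub>H\<^esub> p x \<otimes>\<^bsub>H\<^esub> p (x \<otimes>\<^bsub>G\<^esub> ?k)"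
        using copy[OF 3(2)] 3(6) by blast
      have "inv\<^bsub>H\<^esub> (inv\<^bsub>H\<^esub> h \<otimes>\<^bsub>H\<^esub> f g) \<otimes>\<^bsub>H\<^esub> (inv\<^bsub>H\<^esub> h \<otimes>\<^bsub>H\<^esub> f g') \<in> m_inv H ` D <#>\<^bsub>H\<^esub> D"
        using 3 by (intro set_multI imageI)
      also have "inv\<^bsub>H\<^esub> (inv\<^bsub>H\<^esub> h \<otimes>\<^bsub>H\<^esub> f g) \<otimes>\<^bsub>H\<^esub> (inv\<^bsub>H\<^esub> h \<otimes>\<^bsub>H\<^esub> f g') = inv\<^bsub>H\<^esub> p x \<otimes>\<^bsub>H\<^esub> p (x \<otimes>\<^bsub>G\<^esub> ?k)"
        using 3 x f_cl by (simp add: H.ldiff_inv H.ldiff_trans G.mult_ldiff)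
      finally have "inv\<^bsub>G\<^esub> x \<otimes>\<^bsub>G\<^esub> (x \<otimes>\<^bsub>G\<^esub> ?k) \<in> K'" using x 3 by (intro K'(2)) auto
      then show ?case using x 3 by (simp add: G.ldiff_mult K_def)
    next
      case (4 h g t)
      let ?d = "inv\<^bsub>H\<^esub> h \<otimes>\<^bsub>H\<^esub> f g"
      have cl: "t \<in> carrier H" "?d \<in> carrier H" using 4 H.S_closed f_cl by auto
      obtain x where x: "x \<in> carrier G" "\<forall>k\<in>G.word_ball M. inv\<^bsub>H\<^esub> f g \<otimes>\<^bsub>H\<^esub> f (g \<otimes>\<^bsub>G\<^esub> k) = inv\<^bsub>H\<^esub> p x \<otimes>\<^bsub>H\<^esub> p (x \<otimes>\<^bsub>G\<^esub> k)"
        using copy[OF 4(2)] by blast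
      \<comment> \<open>In the copy at \<open>x\<close>, the point p x d^-1 takes the place of
        \<open>h\<close>, and \<open>?e\<close> that of its neighbour h t. Density of
        \<open>p\<close> near \<open>?e\<close> supplies \<open>y\<close>, and the displacement from
        \<open>x\<close> to \<open>y\<close> is transported back to \<open>g\<close>.\<close>
      let ?e = "p x \<otimes>\<^bsub>H\<^esub> inv\<^bsub>H\<^esub> ?d \<otimes>\<^bsub>H\<^esub> t"
      have e: "?e \<in> carrier H" using x cl p_cl by simp
      obtain y where y: "y \<in> carrier G" "inv\<^bsub>H\<^esub> ?e \<otimes>\<^bsub>H\<^esub> p y \<in> D" using dense[OF e] by blast
      let ?k = "inv\<^bsub>G\<^esub> x \<otimes>\<^bsub>G\<^esub> y"
      define d' where "d' = inv\<^bsub>H\<^esub> ?e \<otimes>\<^bsub>H\<^esub> p y"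
      have d': "d' \<in> carrier H" "d' \<in> D" using e y p_cl by (simp_all add: d'_def)
      have py: "p y = ?e \<otimes>\<^bsub>H\<^esub> d'" using e y p_cl by (simp add: d'_def H.mult_ldiff)
      have eq: "inv\<^bsub>H\<^esub> p x \<otimes>\<^bsub>H\<^esub> p y = inv\<^bsub>H\<^esub> ?d \<otimes>\<^bsub>H\<^esub> t \<otimes>\<^bsub>H\<^esub> d'"
        unfolding py using cl d' x p_cl by (simp add: H.m_assoc H.ldiff_mult)
      have "inv\<^bsub>H\<^esub> p x \<otimes>\<^bsub>H\<^esub> p y \<in> m_inv H ` D <#>\<^bsub>H\<^esub> T <#>\<^bsub>H\<^esub> D"
        unfolding eq using 4 d' by (intro set_multI imageI)
      then have "?k \<in> K\<^sub>1" using x y by (intro K\<^sub>1(2))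
      then have k: "?k \<in> G.word_ball m" "?k \<in> carrier G" using m x y by auto
      then have kM: "?k \<in> G.word_ball M" using R'(6) by blast
      have "inv\<^bsub>H\<^esub> f g \<otimes>\<^bsub>H\<^esub> f (g \<otimes>\<^bsub>G\<^esub> ?k) = inv\<^bsub>H\<^esub> p x \<otimes>\<^bsub>H\<^esub> p y"
        using x(2) kM x(1) y by (simp add: G.mult_ldiff)
      also have "\<dots> = inv\<^bsub>H\<^esub> f g \<otimes>\<^bsub>H\<^esub> (h \<otimes>\<^bsub>H\<^esub> t \<otimes>\<^bsub>H\<^esub> d')"
        unfolding eq using 4 cl d' f_cl by (simp add: H.ldiff_inv H.m_assoc)
      finally have "f g \<otimes>\<^bsub>H\<^esub> (inv\<^bsub>H\<^esub> f g \<otimes>\<^bsub>H\<^esub> f (g \<otimes>\<^bsub>G\<^esub> ?k)) =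
          f g \<otimes>\<^bsub>H\<^esub> (inv\<^bsub>H\<^esub> f g \<otimes>\<^bsub>H\<^esub> (h \<otimes>\<^bsub>H\<^esub> t \<otimes>\<^bsub>H\<^esub> d'))" by (rule arg_cong)
      moreover have "f (g \<otimes>\<^bsub>G\<^esub> ?k) \<in> carrier H" "f g \<in> carrier H" "h \<otimes>\<^bsub>H\<^esub> t \<otimes>\<^bsub>H\<^esub> d' \<in> carrier H"
        using 4 cl(1) d' k(2) by (auto intro!: f_cl)
      ultimately have fk: "f (g \<otimes>\<^bsub>G\<^esub> ?k) = h \<otimes>\<^bsub>H\<^esub> t \<otimes>\<^bsub>H\<^esub> d'"
        by (simp only: H.mult_ldiff)
      have "inv\<^bsub>H\<^esub> (h \<otimes>\<^bsub>H\<^esub> t) \<otimes>\<^bsub>H\<^esub> f (g \<otimes>\<^bsub>G\<^esub> ?k) = d'"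
        unfolding fk using 4 cl d' by (intro H.ldiff_mult) auto
      then show ?case using d' k 4 by (intro bexI[of _ "g \<otimes>\<^bsub>G\<^esub> ?k"]) (auto simp: G.ldiff_mult)
    next
      case (5 g s)
      have s: "s \<in> G.word_ball M" "s \<in> carrier G" using 5 R'(5) G.S_closed by auto
      obtain x where "x \<in> carrier G" "inv\<^bsub>H\<^esub> f g \<otimes>\<^bsub>H\<^esub> f (g \<otimes>\<^bsub>G\<^esub> s) = inv\<^bsub>H\<^esub> p x \<otimes>\<^bsub>H\<^esub> p (x \<otimes>\<^bsub>G\<^esub> s)"
        using copy[OF 5(1)] s by blast
      then show ?case using c[of x s] 5 H.word_ball_mono[of c N] by (auto simp: N_def)
    qed (fact bp K(2) R')+
  qed
  show ?thesis
  proof (rule that[OF D(1,2) K(1), of M\<^sub>0])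
    fix f M g g' assume "M\<^sub>0 \<le> M" "f \<in> carrier G \<rightarrow> carrier H" "locally_like G H (G.word_ball M) f p"
      and g: "g \<in> carrier G" "g' \<in> carrier G" "f g = f g'"
    then interpret local_lifting G S H T f D K M m N by (intro lifting)
    show "inv\<^bsub>G\<^esub> g \<otimes>\<^bsub>G\<^esub> g' \<in> K" using g by (rule fibre_bounded)
  next
    fix f M h assume "M\<^sub>0 \<le> M" "f \<in> carrier G \<rightarrow> carrier H" "locally_like G H (G.word_ball M) f p"
      and h: "h \<in> carrier H"
    then interpret local_lifting G S H T f D K M m N by (intro lifting)
    show "\<exists>g\<in>carrier G. inv\<^bsub>H\<^esub> h \<otimes>\<^bsub>H\<^esub> f g \<in> D" using h by (rule image_dense)
  qed
qed

section \<open>Rigidity\<close>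

text \<open>Kernel elements share their value with the identity, which puts them in
  \<open>K\<close>. For the index, \<open>f\<close> maps each right coset of
  \<open>G\<^sub>0\<close> into one right coset of \<open>H\<^sub>0\<close>, and every
  \<open>h\<close> is some f g d^-1 with d in \<open>D\<close>.\<close>

lemma finite_index_partial_hom:
  assumes "group G" "group H" and G\<^sub>0: "finite_index G G\<^sub>0"
    and f: "f \<in> carrier G \<rightarrow> carrier H"
    and mult: "\<And>a g. a \<in> G\<^sub>0 \<Longrightarrow> g \<in> carrier G \<Longrightarrow> f (a \<otimes>\<^bsub>G\<^esub> g) = f a \<otimes>\<^bsub>H\<^esub> f g"
    and K: "finite K" "\<And>g g'. g \<in> carrier G \<Longrightarrow> g' \<in> carrier G \<Longrightarrow> f g = f g' \<Longrightarrow> inv\<^bsub>G\<^esub> g \<otimes>\<^bsub>G\<^esub> g' \<in> K"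
    and D: "finite D" "D \<subseteq> carrier H"
      "\<And>h. h \<in> carrier H \<Longrightarrow> \<exists>g\<in>carrier G. inv\<^bsub>H\<^esub> h \<otimes>\<^bsub>H\<^esub> f g \<in> D"
  shows "\<exists>H\<^sub>0 N. finite_index H H\<^sub>0 \<and> finite N \<and> N \<lhd> G\<lparr>carrier := G\<^sub>0\<rparr> \<and>
    H\<lparr>carrier := H\<^sub>0\<rparr> \<cong> G\<lparr>carrier := G\<^sub>0\<rparr> Mod N"
proof -
  interpret G: group G by fact
  interpret H: group H by fact
  let ?G = "G\<lparr>carrier := G\<^sub>0\<rparr>"
  have sub: "subgroup G\<^sub>0 G" and fin: "finite (rcosets\<^bsub>G\<^esub> G\<^sub>0)" using G\<^sub>0 by (auto simp: finite_index_def)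
  have G\<^sub>0G: "G\<^sub>0 \<subseteq> carrier G" using sub by (rule subgroup.subset)
  define H\<^sub>0 where "H\<^sub>0 = f ` G\<^sub>0"
  let ?H = "H\<lparr>carrier := H\<^sub>0\<rparr>"
  have grpG: "group ?G" using sub by (rule G.subgroup_imp_group)
  have f_hom: "f \<in> hom ?G H" using f mult G\<^sub>0G by (auto simp: hom_def)
  interpret fH: group_hom ?G H f by (intro group_hom.intro grpG H.is_group group_hom_axioms.intro f_hom)
  have H\<^sub>0: "subgroup H\<^sub>0 H" using fH.img_is_subgroup by (simp add: H\<^sub>0_def)
  have grpH: "group ?H" using H\<^sub>0 by (rule H.subgroup_imp_group)
  have "f \<in> hom ?G ?H" using mult G\<^sub>0G by (auto simp: hom_def H\<^sub>0_def)
  then interpret fH\<^sub>0: group_hom ?G ?H f by (intro group_hom.intro grpG grpH group_hom_axioms.intro)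
  define N where "N = kernel ?G ?H f"
  have "?G Mod N \<cong> ?H" unfolding N_def by (rule fH\<^sub>0.FactGroup_iso) (simp add: H\<^sub>0_def)
  moreover have "group (?G Mod N)" unfolding N_def by (intro normal.factorgroup_is_group fH\<^sub>0.normal_kernel)
  ultimately have iso: "?H \<cong> ?G Mod N" using group.iso_sym by blast
  have "N \<subseteq> K"
  proof
    fix a assume "a \<in> N"
    then have a: "a \<in> G\<^sub>0" "f a = \<one>\<^bsub>H\<^esub>" by (auto simp: N_def kernel_def)
    then have "a \<in> carrier G" using G\<^sub>0G by auto
    moreover have "f \<one>\<^bsub>G\<^esub> = \<one>\<^bsub>H\<^esub>" using fH.hom_one by simp
    ultimately show "a \<in> K" using K(2)[of "\<one>\<^bsub>G\<^esub>" a] a by simp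
  qed
  then have finN: "finite N" using K(1) finite_subset by blast
  \<comment> \<open>The choice of representative is harmless: another one changes the value of
    \<open>f\<close> by a left factor in \<open>H\<^sub>0\<close>.\<close>
  let ?c = "\<lambda>(C, d). H\<^sub>0 #>\<^bsub>H\<^esub> (f (SOME g. g \<in> C) \<otimes>\<^bsub>H\<^esub> inv\<^bsub>H\<^esub> d)"
  have "rcosets\<^bsub>H\<^esub> H\<^sub>0 \<subseteq> ?c ` ((rcosets\<^bsub>G\<^esub> G\<^sub>0) \<times> D)"
  proof
    fix C assume "C \<in> rcosets\<^bsub>H\<^esub> H\<^sub>0"
    then obtain h where h: "h \<in> carrier H" "C = H\<^sub>0 #>\<^bsub>H\<^esub> h" by (auto simp: RCOSETS_def)
    obtain g where g: "g \<in> carrier G" "inv\<^bsub>H\<^esub> h \<otimes>\<^bsub>H\<^esub> f g \<in> D" using D(3)[OF h(1)] by blast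
    let ?d = "inv\<^bsub>H\<^esub> h \<otimes>\<^bsub>H\<^esub> f g" and ?B = "G\<^sub>0 #>\<^bsub>G\<^esub> g"
    have fg: "f g \<in> carrier H" using f g by auto
    have "f g \<otimes>\<^bsub>H\<^esub> inv\<^bsub>H\<^esub> ?d = f g \<otimes>\<^bsub>H\<^esub> (inv\<^bsub>H\<^esub> f g \<otimes>\<^bsub>H\<^esub> h)" using h fg by (simp add: H.ldiff_inv)
    then have hd: "h = f g \<otimes>\<^bsub>H\<^esub> inv\<^bsub>H\<^esub> ?d" using h fg by (simp add: H.mult_ldiff)
    have "(SOME x. x \<in> ?B) \<in> ?B" using G.rcos_self[OF g(1) sub] by (rule someI)
    then obtain a where a: "a \<in> G\<^sub>0" "(SOME x. x \<in> ?B) = a \<otimes>\<^bsub>G\<^esub> g" by (auto simp: r_coset_def)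
    have fa: "f a \<in> carrier H" "f a \<in> H\<^sub>0" using a G\<^sub>0G f by (auto simp: H\<^sub>0_def)
    have "f (SOME x. x \<in> ?B) \<otimes>\<^bsub>H\<^esub> inv\<^bsub>H\<^esub> ?d = f a \<otimes>\<^bsub>H\<^esub> (f g \<otimes>\<^bsub>H\<^esub> inv\<^bsub>H\<^esub> ?d)"
      unfolding a(2) mult[OF a(1) g(1)] using fa fg h by (simp add: H.m_assoc)
    also have "\<dots> = f a \<otimes>\<^bsub>H\<^esub> h" using hd by simp
    finally have "H\<^sub>0 #>\<^bsub>H\<^esub> (f (SOME x. x \<in> ?B) \<otimes>\<^bsub>H\<^esub> inv\<^bsub>H\<^esub> ?d) = H\<^sub>0 #>\<^bsub>H\<^esub> (f a \<otimes>\<^bsub>H\<^esub> h)" by simp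
    also have "\<dots> = (H\<^sub>0 #>\<^bsub>H\<^esub> f a) #>\<^bsub>H\<^esub> h"
      using H.coset_mult_assoc[OF subgroup.subset[OF H\<^sub>0] fa(1) h(1)] by simp
    also have "\<dots> = C" using subgroup.rcos_const[OF H\<^sub>0 H.is_group fa(2)] h(2) by simp
    finally have "C = ?c (?B, ?d)" by simp
    moreover have "?B \<in> rcosets\<^bsub>G\<^esub> G\<^sub>0" using g(1) by (auto simp: RCOSETS_def)
    ultimately show "C \<in> ?c ` ((rcosets\<^bsub>G\<^esub> G\<^sub>0) \<times> D)" using g(2) by (intro image_eqI[of _ _ "(?B, ?d)"]) auto
  qed
  then have "finite (rcosets\<^bsub>H\<^esub> H\<^sub>0)" using fin D(1) by (meson finite_SigmaI finite_imageI finite_subset)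
  then have "finite_index H H\<^sub>0" using H\<^sub>0 by (simp add: finite_index_def)
  moreover have "N \<lhd> ?G" unfolding N_def by (rule fH\<^sub>0.normal_kernel)
  ultimately show ?thesis using finN iso by blast
qed

lemma coarse_equivalence_rigidity:
  assumes G: "word_group G S" and N: "boundedly_presented G S N"
    and H: "word_group H T" and N': "boundedly_presented H T N'"
    and p: "coarse_equivalence G H p" and no_sft: "\<not> has_weakly_aperiodic_SFT G"
  shows "\<exists>G\<^sub>0 H\<^sub>0 N. finite_index G G\<^sub>0 \<and> finite_index H H\<^sub>0 \<and>
           finite N \<and> N \<lhd> G\<lparr>carrier := G\<^sub>0\<rparr> \<and>
           H\<lparr>carrier := H\<^sub>0\<rparr> \<cong> G\<lparr>carrier := G\<^sub>0\<rparr> Mod N"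
proof -
  interpret G: word_group G S by fact
  interpret H: word_group H T by fact
  note p_cl = coarse_equivalence_closed[OF p]
  obtain D K M\<^sub>0 where D: "finite D" "D \<subseteq> carrier H" and K: "finite K"
    and fibre: "\<And>f M g g'. M\<^sub>0 \<le> M \<Longrightarrow> f \<in> carrier G \<rightarrow> carrier H \<Longrightarrow>
      locally_like G H (G.word_ball M) f p \<Longrightarrow>
      g \<in> carrier G \<Longrightarrow> g' \<in> carrier G \<Longrightarrow> f g = f g' \<Longrightarrow> inv\<^bsub>G\<^esub> g \<otimes>\<^bsub>G\<^esub> g' \<in> K"
    and dense: "\<And>f M h. M\<^sub>0 \<le> M \<Longrightarrow> f \<in> carrier G \<rightarrow> carrier H \<Longrightarrow>
      locally_like G H (G.word_ball M) f p \<Longrightarrow>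
      h \<in> carrier H \<Longrightarrow> \<exists>g\<in>carrier G. inv\<^bsub>H\<^esub> h \<otimes>\<^bsub>H\<^esub> f g \<in> D"
    by (rule locally_like_geometry[OF G H N' p]) (rule that)
  \<comment> \<open>\<open>N\<close> is for integration, \<open>M\<^sub>0\<close> for the geometry
    of fibres and image; the successor ensures that single generators lie in the ball.\<close>
  define M where "M = Suc (max N M\<^sub>0)"
  let ?B = "G.word_ball M"
  \<comment> \<open>One letter stores the differences to all points of a ball. A pattern of radius
    \<open>M\<close> thus fixes the differences between g' k and g' k l for all k, l in the ball, as
    integration requires; restricting to the ball keeps the alphabet finite.\<close>
  define \<Delta> where "\<Delta> g = (\<lambda>k\<in>?B. inv\<^bsub>H\<^esub> p g \<otimes>\<^bsub>H\<^esub> p (g \<otimes>\<^bsub>G\<^esub> k))" for g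
  obtain c where c: "\<And>g k. g \<in> carrier G \<Longrightarrow> k \<in> ?B \<Longrightarrow>
      inv\<^bsub>H\<^esub> p g \<otimes>\<^bsub>H\<^esub> p (g \<otimes>\<^bsub>G\<^esub> k) \<in> H.word_ball c"
    using coarse_equivalence_step_bound[OF G H p G.word_ball_finite G.word_ball_closed] by blast
  have "\<Delta> ` carrier G \<subseteq> (?B \<rightarrow>\<^sub>E H.word_ball c)" using c by (auto simp: \<Delta>_def)
  then have "finite (\<Delta> ` carrier G)"
    using finite_PiE[OF G.word_ball_finite, of M "\<lambda>_. H.word_ball c"] H.word_ball_finite finite_subset by blast
  then obtain \<delta> G\<^sub>0 where G\<^sub>0: "finite_index G G\<^sub>0"
    and per: "\<And>a g. a \<in> G\<^sub>0 \<Longrightarrow> g \<in> carrier G \<Longrightarrow> \<delta> (a \<otimes>\<^bsub>G\<^esub> g) = \<delta> g"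
    and copy: "\<And>g. g \<in> carrier G \<Longrightarrow> \<exists>g'\<in>carrier G. \<forall>k\<in>?B. \<delta> (g \<otimes>\<^bsub>G\<^esub> k) = \<Delta> (g' \<otimes>\<^bsub>G\<^esub> k)"
    by (rule G.periodic_local_copy[OF no_sft G.word_ball_finite G.word_ball_closed]) (rule that)
  have copy': "\<exists>g'\<in>carrier G. \<forall>k\<in>?B. \<forall>l\<in>?B.
      \<delta> (g \<otimes>\<^bsub>G\<^esub> k) l = inv\<^bsub>H\<^esub> p (g' \<otimes>\<^bsub>G\<^esub> k) \<otimes>\<^bsub>H\<^esub> p (g' \<otimes>\<^bsub>G\<^esub> k \<otimes>\<^bsub>G\<^esub> l)" if "g \<in> carrier G" for g
  proof -
    obtain g' where g': "g' \<in> carrier G" "\<forall>k\<in>?B. \<delta> (g \<otimes>\<^bsub>G\<^esub> k) = \<Delta> (g' \<otimes>\<^bsub>G\<^esub> k)"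
      using copy[OF \<open>g \<in> carrier G\<close>] by blast
    then show ?thesis by (intro bexI[of _ g']) (simp_all add: \<Delta>_def)
  qed
  have G\<^sub>0_closed: "G\<^sub>0 \<subseteq> carrier G" using G\<^sub>0 by (auto simp: finite_index_def dest: subgroup.subset)
  have M: "N \<le> M" "1 \<le> M" "M\<^sub>0 \<le> M" by (auto simp: M_def)
  obtain f where f: "f \<in> carrier G \<rightarrow> carrier H" "locally_like G H ?B f p"
    and mult: "\<And>a g. a \<in> G\<^sub>0 \<Longrightarrow> g \<in> carrier G \<Longrightarrow> f (a \<otimes>\<^bsub>G\<^esub> g) = f a \<otimes>\<^bsub>H\<^esub> f g"
    by (rule integrate_local_data[OF G N H.is_group p_cl M(1,2) copy' G\<^sub>0_closed per]) (assumption+, rule that)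
  show ?thesis
    using finite_index_partial_hom[OF G.is_group H.is_group G\<^sub>0 f(1) mult K
        fibre[OF M(3) f] D dense[OF M(3) f]] G\<^sub>0 by blast
qed

theorem theorem1p11:
  fixes G :: "('a, 'm) monoid_scheme" and H :: "('b, 'n) monoid_scheme"
  assumes "group G" and "finitely_presented G"
    and "\<not> has_weakly_aperiodic_SFT G"
    and "group H" and "finitely_generated H"
    and "quasi_isometric_groups H G"
  shows "\<exists>G\<^sub>0 H\<^sub>0 N. finite_index G G\<^sub>0 \<and> finite_index H H\<^sub>0 \<and>
           finite N \<and> N \<lhd> G\<lparr>carrier := G\<^sub>0\<rparr> \<and>
           H\<lparr>carrier := H\<^sub>0\<rparr> \<cong> G\<lparr>carrier := G\<^sub>0\<rparr> Mod N"
proof -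
  interpret G: group G by fact
  obtain S N where S: "word_group G S" "boundedly_presented G S N"
    using G.finitely_presented_bounded assms(2) by blast
  obtain q T where q: "coarse_equivalence H G q" and T: "word_group H T"
    using quasi_isometric_groups_coarse_equivalence[OF assms(4,1,6)] by blast
  \<comment> \<open>The given quasi isometry starts in \<open>H\<close>, while the subshift on
    \<open>G\<close> is built from a map out of \<open>G\<close>; hence the coarse inverse. Both
    maps are then used to transfer the presentation.\<close>
  obtain p D where p: "coarse_equivalence G H p" and D: "finite D"
    "\<And>x. x \<in> carrier H \<Longrightarrow> inv\<^bsub>H\<^esub> x \<otimes>\<^bsub>H\<^esub> p (q x) \<in> D"
    using coarse_equivalence_inverse[OF assms(4,1) q] by blast
  obtain M where "boundedly_presented H T M"
    using boundedly_presented_coarse_equivalence[OF S(1) T S(2) q p D] by blast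
  then show ?thesis using coarse_equivalence_rigidity[OF S T _ p assms(3)] by blast
qed

end
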